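(* The problem of finding a minimum-size independent feedback vertex set of a graph of diameter $2$ (or determining that none exists) can be solved in polynomial time.
   Context: All graphs are finite and simple. For a graph $G=(V,E)$, an independent feedback vertex set is a set $A\subseteq V$ that is independent and such that $G[V\setminus A]$ is a forest. The diameter of $G$ is the maximum, over all pairs of vertices, of the number of edges of a shortest path between them. *)

theory Defs
  imports "Graph_Theory.Graph_Theory" "HOL-Computational_Algebra.Polynomial"
begin

section \<open>Independent feedback vertex sets\<close>

text \<open>
  A finite simple graph is represented as a finite, symmetric, loop-free digraph without parallel
  arcs (locale \<^locale>\<open>graph\<close>, or \<^locale>\<open>pair_graph\<close>).
\<close>

text \<open>Pairs of vertices in different components have distance \<open>\<infinity>\<close>.\<close>

definition graph_diameter :: "('a, 'b) pre_digraph \<Rightarrow> ereal" where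
  "graph_diameter G = (SUP u \<in> verts G. SUP v \<in> verts G. wf_digraph.\<mu> G (\<lambda>_. 1) u v)"

text \<open>
  An edge of the undirected graph is a pair of opposite arcs, which is a directed cycle
  of length 2; hence the library's \<^const>\<open>forest\<close> is not the undirected notion. The cycles of the
  undirected graph are exactly the directed cycles of length at least 3.
\<close>

definition undirected_forest :: "('a, 'b) pre_digraph \<Rightarrow> bool" where
  "undirected_forest G \<longleftrightarrow> \<not> (\<exists>p. pre_digraph.cycle G p \<and> 3 \<le> length p)"

definition independent_in :: "('a, 'b) pre_digraph \<Rightarrow> 'a set \<Rightarrow> bool" where
  "independent_in G A \<longleftrightarrow> (\<forall>u \<in> A. \<forall>v \<in> A. (u, v) \<notin> arcs_ends G)"

definition indep_fvs :: "('a, 'b) pre_digraph \<Rightarrow> 'a set \<Rightarrow> bool" where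
  "indep_fvs G A \<longleftrightarrow>
     A \<subseteq> verts G \<and> independent_in G A \<and> undirected_forest (G \<restriction> (verts G - A))"

fun min_indep_fvs_answer :: "('a, 'b) pre_digraph \<Rightarrow> 'a set option \<Rightarrow> bool" where
  "min_indep_fvs_answer G None \<longleftrightarrow> \<not> (\<exists>A. indep_fvs G A)"
| "min_indep_fvs_answer G (Some A) \<longleftrightarrow> is_arg_min card (indep_fvs G) A"


section \<open>Polynomial time\<close>

text \<open>
  The model of computation is a random access machine, programmed in a structured language:
  a program has finitely many named arrays, each indexed by the natural numbers
  and holding natural numbers; a scalar variable \<open>x\<close> is the cell \<open>x[0]\<close>. Every operation
  has unit cost. The only arithmetic operations are addition and truncated subtraction, so in
  \<open>t\<close> steps the bit length of the stored numbers grows by at most \<open>O(t)\<close>. The model is therefore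
  polynomially equivalent to Turing machines (this argument fails for unit-cost multiplication).
\<close>

type_synonym vname = string
type_synonym state = "vname \<Rightarrow> nat \<Rightarrow> nat"

datatype exp =
    Num nat
  | Cell vname exp
  | Add exp exp
  | Sub exp exp

datatype test =
    Less exp exp
  | Neg test
  | Conj test test

datatype com =
    Skip
  | Store vname exp exp  \<comment> \<open>\<open>Store x i e\<close> is the assignment \<open>x[i] := e\<close>\<close>
  | Seq com com
  | Cond test com com
  | While test com

primrec exp_val :: "exp \<Rightarrow> state \<Rightarrow> nat" where
  "exp_val (Num k) s = k"
| "exp_val (Cell x i) s = s x (exp_val i s)"
| "exp_val (Add a b) s = exp_val a s + exp_val b s"
| "exp_val (Sub a b) s = exp_val a s - exp_val b s"

primrec exp_cost :: "exp \<Rightarrow> nat" where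
  "exp_cost (Num k) = 1"
| "exp_cost (Cell x i) = 1 + exp_cost i"
| "exp_cost (Add a b) = 1 + exp_cost a + exp_cost b"
| "exp_cost (Sub a b) = 1 + exp_cost a + exp_cost b"

primrec test_val :: "test \<Rightarrow> state \<Rightarrow> bool" where
  "test_val (Less a b) s \<longleftrightarrow> exp_val a s < exp_val b s"
| "test_val (Neg b) s \<longleftrightarrow> \<not> test_val b s"
| "test_val (Conj b c) s \<longleftrightarrow> test_val b s \<and> test_val c s"

primrec test_cost :: "test \<Rightarrow> nat" where
  "test_cost (Less a b) = 1 + exp_cost a + exp_cost b"
| "test_cost (Neg b) = 1 + test_cost b"
| "test_cost (Conj b c) = 1 + test_cost b + test_cost c"

text \<open>\<open>runs c s t s'\<close>: started in \<open>s\<close>, the program \<open>c\<close> halts after \<open>t\<close> steps in \<open>s'\<close>.\<close>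

inductive runs :: "com \<Rightarrow> state \<Rightarrow> nat \<Rightarrow> state \<Rightarrow> bool" where
  Skip: "runs Skip s 1 s"
| Store: "runs (Store x i e) s (1 + exp_cost i + exp_cost e)
            (s(x := (s x)(exp_val i s := exp_val e s)))"
| Seq: "runs c s t s' \<Longrightarrow> runs d s' u s'' \<Longrightarrow> runs (Seq c d) s (1 + t + u) s''"
| CondTrue: "test_val b s \<Longrightarrow> runs c s t s' \<Longrightarrow> runs (Cond b c d) s (1 + test_cost b + t) s'"
| CondFalse: "\<not> test_val b s \<Longrightarrow> runs d s t s' \<Longrightarrow> runs (Cond b c d) s (1 + test_cost b + t) s'"
| WhileFalse: "\<not> test_val b s \<Longrightarrow> runs (While b c) s (1 + test_cost b) s"
| WhileTrue: "test_val b s \<Longrightarrow> runs c s t s' \<Longrightarrow> runs (While b c) s' u s'' \<Longrightarrow>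
            runs (While b c) s (1 + test_cost b + t + u) s''"

inductive_cases runs_SkipE: "runs Skip s t s'"
inductive_cases runs_StoreE: "runs (Store x i e) s t s'"
inductive_cases runs_SeqE: "runs (Seq c d) s t s'"
inductive_cases runs_CondE: "runs (Cond b c d) s t s'"
inductive_cases runs_WhileE: "runs (While b c) s t s'"

lemma runs_deterministic: "runs c s t s' \<Longrightarrow> runs c s u s'' \<Longrightarrow> u = t \<and> s'' = s'"
proof (induction arbitrary: u s'' rule: runs.induct)
  case (Seq c s t s' d v s2)
  from Seq.prems show ?case by (rule runs_SeqE) (auto dest: Seq.IH)
next
  case (CondTrue b s c t s' d)
  from CondTrue.prems show ?case
    by (rule runs_CondE) (use CondTrue.hyps in \<open>auto dest: CondTrue.IH\<close>)
next
  case (CondFalse b s d t s' c)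
  from CondFalse.prems show ?case
    by (rule runs_CondE) (use CondFalse.hyps in \<open>auto dest: CondFalse.IH\<close>)
next
  case (WhileTrue b s c t s' v s2)
  from WhileTrue.prems show ?case
    by (rule runs_WhileE) (use WhileTrue.hyps in \<open>auto dest: WhileTrue.IH\<close>)
next
  case (WhileFalse b s c)
  from WhileFalse.prems show ?case
    by (rule runs_WhileE) (use WhileFalse.hyps in auto)
qed (auto elim: runs_SkipE runs_StoreE)

text \<open>
  A search problem has a set \<open>I\<close> of instances, and \<open>R x y\<close> says that \<open>y\<close> is a correct answer to
  the instance \<open>x\<close>. Nothing is demanded of the program on inputs outside \<open>I\<close>.
\<close>

definition poly_time_solvable ::
  "'i set \<Rightarrow> ('i \<Rightarrow> 'o \<Rightarrow> bool) \<Rightarrow> ('i \<Rightarrow> nat) \<Rightarrow> ('i \<Rightarrow> state) \<Rightarrow> (state \<Rightarrow> 'o) \<Rightarrow> bool" where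
  "poly_time_solvable I R size_of encode decode \<longleftrightarrow>
     (\<exists>(c :: com) (p :: nat poly). \<forall>x \<in> I. \<exists>t s.
        runs c (encode x) t s \<and> t \<le> poly p (size_of x) \<and> R x (decode s))"


section \<open>Graphs as inputs, vertex sets as outputs\<close>

text \<open>An input graph has vertices \<open>0, \<dots>, n - 1\<close> and is given by \<open>n\<close> and its adjacency matrix.\<close>

definition input_graph :: "nat pair_pre_digraph \<Rightarrow> bool" where
  "input_graph G \<longleftrightarrow> pair_graph G \<and> pverts G = {..<card (pverts G)}"

definition encode_graph :: "nat pair_pre_digraph \<Rightarrow> state" where
  "encode_graph G = (let n = card (pverts G) in
     (\<lambda>_ _. 0)(
       ''n'' := (\<lambda>_. 0)(0 := n),
       ''adj'' := (\<lambda>k. if \<exists>i < n. \<exists>j < n. k = i * n + j \<and> (i, j) \<in> parcs G then 1 else 0)))"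

definition decode_vertex_set :: "state \<Rightarrow> nat set option" where
  "decode_vertex_set s = (if s ''found'' 0 = 0 then None else Some {v. s ''set'' v \<noteq> 0})"

end

theory Submission
  imports Defs
begin

text \<open>
  Let \<open>F\<close> be the forest left by an independent feedback vertex set \<open>A\<close>. Every neighbour of a vertex
  of \<open>A\<close> lies in \<open>F\<close>, so by diameter 2 each vertex of \<open>A\<close> has a common neighbour in \<open>F\<close> with every
  vertex not adjacent to it. If \<open>F\<close> has an edge, deleting its leaves and looking at a vertex of degree
  at most 1 in the rest gives a leaf \<open>v\<close> whose neighbour \<open>u\<close> has at most one non-leaf neighbour \<open>x\<close>
  in \<open>F\<close>. A vertex of \<open>A\<close> that misses \<open>v\<close> must be adjacent to \<open>u\<close>, because \<open>u\<close> is the only neighbour of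
  \<open>v\<close> in \<open>F\<close>. Hence the set \<open>Z\<close> of vertices adjacent to neither \<open>u\<close> nor \<open>v\<close> lies in \<open>F\<close>. If \<open>Z\<close>
  is nonempty, the same argument with a vertex of \<open>Z\<close> shows that \<open>A\<close> is determined by
  \<open>u\<close>, \<open>v\<close> and \<open>x\<close>, so there are only cubically many candidates. If \<open>Z\<close> is empty, \<open>F\<close> is a star with centre
  \<open>u\<close>, and \<open>A\<close> is one side of a bipartition of the graph without \<open>u\<close> that contains all
  non-neighbours of \<open>u\<close>; a smallest such side is found by choosing the cheaper side of each component.
  All candidates are tested, acyclicity by repeatedly stripping vertices of degree at most 1.
\<close>

section \<open>Independent feedback vertex sets of an adjacency relation\<close>

definition min_deg2 :: "('a \<Rightarrow> 'a \<Rightarrow> bool) \<Rightarrow> 'a set \<Rightarrow> bool" where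
  "min_deg2 E S \<longleftrightarrow> (\<forall>v \<in> S. \<exists>x \<in> S. \<exists>y \<in> S. x \<noteq> y \<and> E v x \<and> E v y)"

text \<open>A finite graph has a cycle exactly when some nonempty vertex set induces minimum degree
  at least 2. In this form acyclicity is what stripping vertices of degree at most 1 decides
  directly, and the combinatorial part can avoid walks.\<close>

definition acyc :: "('a \<Rightarrow> 'a \<Rightarrow> bool) \<Rightarrow> 'a set \<Rightarrow> bool" where
  "acyc E F \<longleftrightarrow> (\<forall>S \<subseteq> F. min_deg2 E S \<longrightarrow> S = {})"

definition indep :: "('a \<Rightarrow> 'a \<Rightarrow> bool) \<Rightarrow> 'a set \<Rightarrow> bool" where
  "indep E A \<longleftrightarrow> (\<forall>u \<in> A. \<forall>v \<in> A. \<not> E u v)"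

definition ifvs :: "'a set \<Rightarrow> ('a \<Rightarrow> 'a \<Rightarrow> bool) \<Rightarrow> 'a set \<Rightarrow> bool" where
  "ifvs V E A \<longleftrightarrow> A \<subseteq> V \<and> indep E A \<and> acyc E (V - A)"

text \<open>Intended for a leaf \<open>v\<close> of the forest with neighbour \<open>u\<close>, all of whose forest neighbours other
  than \<open>x\<close> are leaves. The case \<open>u = v = x\<close> gives the neighbourhood of \<open>u\<close>, which covers forests
  without edges.\<close>

definition tri :: "'a set \<Rightarrow> ('a \<Rightarrow> 'a \<Rightarrow> bool) \<Rightarrow> 'a \<Rightarrow> 'a \<Rightarrow> 'a \<Rightarrow> 'a set" where
  "tri V E u v x = {w \<in> V. w \<noteq> u \<and> w \<noteq> v \<and> w \<noteq> x \<and>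
     (E w v \<or> E w u \<and> (E w x \<or> (\<exists>z \<in> V. \<not> E z u \<and> \<not> E z v \<and> E w z)))}"

definition bipart :: "('a \<Rightarrow> 'a \<Rightarrow> bool) \<Rightarrow> 'a set \<Rightarrow> 'a set \<Rightarrow> bool" where
  "bipart E W B \<longleftrightarrow> B \<subseteq> W \<and> indep E B \<and> indep E (W - B)"

definition star :: "'a set \<Rightarrow> ('a \<Rightarrow> 'a \<Rightarrow> bool) \<Rightarrow> 'a \<Rightarrow> 'a set \<Rightarrow> bool" where
  "star V E u A \<longleftrightarrow> bipart E (V - {u}) A \<and> (\<forall>w \<in> V - {u} - A. E w u)"

section \<open>Stars and leaves in forests\<close>

locale simple_graph =
  fixes V :: "'a set" and E :: "'a \<Rightarrow> 'a \<Rightarrow> bool"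
  assumes finV: "finite V"
    and sym: "E x y \<Longrightarrow> E y x"
    and irrefl: "\<not> E x x"
    and vert: "E x y \<Longrightarrow> x \<in> V"
begin

lemma vert2: "E x y \<Longrightarrow> y \<in> V"
  using sym vert by blast

text \<open>Outside \<open>A\<close>, a vertex other than \<open>u\<close> can only be adjacent to
  \<open>u\<close>, so it never has two neighbours there. A set of minimum degree 2 would thus be
  contained in \<open>{u}\<close>, which offers \<open>u\<close> no two distinct neighbours.\<close>

lemma star_ifvs:
  assumes "star V E u A" shows "ifvs V E A"
proof -
  have "S = {}" if S: "S \<subseteq> V - A" "min_deg2 E S" for S
  proof (rule ccontr)
    assume "S \<noteq> {}"
    have only: "y = u" if "x \<in> S" "x \<noteq> u" "y \<in> S" "E x y" for x y
      using that S(1) assms unfolding star_def bipart_def indep_def by blast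
    have "s = u" if "s \<in> S" for s
      using that S(2) only unfolding min_deg2_def by metis
    with \<open>S \<noteq> {}\<close> S(2) show False
      unfolding min_deg2_def by (metis ex_in_conv)
  qed
  with assms show ?thesis
    unfolding ifvs_def acyc_def star_def bipart_def by blast
qed

text \<open>\<open>S\<close> consists of the vertices of degree at least 2 in \<open>F\<close>. If
  it is nonempty, acyclicity gives a vertex \<open>u\<close> of \<open>S\<close> with at most one
  neighbour \<open>x\<close> in \<open>S\<close>; the other neighbours of \<open>u\<close> in
  \<open>F\<close> see only \<open>u\<close>, and one of them serves as \<open>v\<close>.\<close>

lemma acyc_leaf:
  assumes F: "F \<subseteq> V" "acyc E F" and e: "a \<in> F" "b \<in> F" "E a b"
  obtains u v x where "u \<in> F" "v \<in> F" "x \<in> F" "E u v" "x \<noteq> u"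
    "\<forall>y \<in> F. E v y \<longrightarrow> y = u"
    "\<forall>y \<in> F. \<forall>z \<in> F. E u y \<and> y \<noteq> x \<and> E y z \<longrightarrow> z = u"
proof -
  define S where "S = {w \<in> F. \<exists>y \<in> F. \<exists>z \<in> F. y \<noteq> z \<and> E w y \<and> E w z}"
  have leaf: "y = z" if "w \<in> F" "w \<notin> S" "y \<in> F" "E w y" "z \<in> F" "E w z" for w y z
    using that unfolding S_def by blast
  show thesis
  proof (cases "S = {}")
    case True
    have leaf': "y = z" if "w \<in> F" "y \<in> F" "E w y" "z \<in> F" "E w z" for w y z
      using leaf[of w y z] that True by blast
    show thesis
    \<comment> \<open>With \<open>S\<close> empty the edges of \<open>F\<close> form a matching, so
      the given edge serves as \<open>u\<close>, \<open>v\<close>, and \<open>b\<close> doubles as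
      \<open>x\<close>.\<close>
    proof (rule that[of a b b])
      show "b \<noteq> a" using e irrefl by blast
      show "\<forall>y \<in> F. E b y \<longrightarrow> y = a" using leaf' e sym by blast
      show "\<forall>y \<in> F. \<forall>z \<in> F. E a y \<and> y \<noteq> b \<and> E y z \<longrightarrow> z = a" using leaf' e by blast
    qed (use e in auto)
  next
    case False
    have "S \<subseteq> F" unfolding S_def by blast
    with F(2) False have "\<not> min_deg2 E S" unfolding acyc_def by blast
    then obtain u where u: "u \<in> S" and one: "\<And>y z. y \<in> S \<Longrightarrow> z \<in> S \<Longrightarrow> E u y \<Longrightarrow> E u z \<Longrightarrow> y = z"
      unfolding min_deg2_def by blast
    from u obtain y z where yz: "y \<in> F" "z \<in> F" "y \<noteq> z" "E u y" "E u z" "u \<in> F"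
      unfolding S_def by blast
    then obtain v where v: "v \<in> F" "E u v" "v \<notin> S" using one by blast
    show thesis
    proof (cases "\<exists>x \<in> S. E u x")
      case True
      then obtain x where x: "x \<in> S" "E u x" by blast
      show thesis
      proof (rule that[of u v x])
        show "x \<in> F" using x \<open>S \<subseteq> F\<close> by blast
        show "x \<noteq> u" using x irrefl by blast
        show "\<forall>y \<in> F. E v y \<longrightarrow> y = u" using leaf[of v _ u] v yz sym by blast
        show "\<forall>y \<in> F. \<forall>z \<in> F. E u y \<and> y \<noteq> x \<and> E y z \<longrightarrow> z = u"
          using leaf[of _ _ u] one[of x] x yz sym by blast
      qed (use v yz in auto)
    next
      case nox: False
      show thesis
      \<comment> \<open>All neighbours of \<open>u\<close> in \<open>F\<close> are leaves;
        \<open>v\<close> stands in for \<open>x\<close>, which has to lie in \<open>F\<close> and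
        differ from \<open>u\<close>.\<close>
      proof (rule that[of u v v])
        show "v \<noteq> u" using v irrefl by blast
        show "\<forall>y \<in> F. E v y \<longrightarrow> y = u" using leaf[of v _ u] v yz sym by blast
        show "\<forall>y \<in> F. \<forall>z \<in> F. E u y \<and> y \<noteq> v \<and> E y z \<longrightarrow> z = u"
          using leaf[of _ _ u] nox yz sym by blast
      qed (use v yz in auto)
    qed
  qed
qed

end

section \<open>Structure of independent feedback vertex sets in diameter 2\<close>

locale diam2_graph = simple_graph +
  assumes diam2: "x \<in> V \<Longrightarrow> y \<in> V \<Longrightarrow> x \<noteq> y \<Longrightarrow> \<not> E x y \<Longrightarrow> \<exists>z. E x z \<and> E z y"
    and edge: "\<exists>x y. E x y"
begin

lemma ifvs_cases:
  assumes A: "ifvs V E A"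
  shows "(\<exists>u \<in> V. \<exists>v \<in> V. \<exists>x \<in> V. A = tri V E u v x) \<or> (\<exists>u \<in> V. star V E u A)"
proof -
  define F where "F = V - A"
  have AV: "A \<subseteq> V" and FV: "F \<subseteq> V" and indA: "\<And>x y. x \<in> A \<Longrightarrow> y \<in> A \<Longrightarrow> \<not> E x y"
    and F: "acyc E F" and VAF: "\<And>x. x \<in> V \<Longrightarrow> x \<in> A \<or> x \<in> F" and disj: "\<And>x. x \<in> A \<Longrightarrow> x \<notin> F"
    using A unfolding F_def ifvs_def indep_def by auto
  have nbF: "y \<in> F" if "x \<in> A" "E x y" for x y
    using that indA VAF vert2 by blast
  show ?thesis
  proof (cases "\<exists>a \<in> F. \<exists>b \<in> F. E a b")
    case False
    \<comment> \<open>An edge has an endpoint outside the independent set \<open>A\<close>, so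
      \<open>F\<close> is nonempty. Neighbours of \<open>b\<close> lie in \<open>A\<close> because
      \<open>F\<close> has no edges, and a vertex of \<open>A\<close> missing \<open>b\<close> would
      share a neighbour in \<open>F\<close> with it; hence \<open>A\<close> is the neighbourhood of
      \<open>b\<close>.\<close>
    from edge obtain b where b: "b \<in> F" using indA VAF vert vert2 by blast
    have "x \<in> A \<longleftrightarrow> E x b" for x
    proof
      assume x: "x \<in> A"
      show "E x b"
      proof (rule ccontr)
        assume "\<not> E x b"
        moreover have "x \<noteq> b" using x b disj by blast
        ultimately obtain z where "E x z" "E z b" using diam2[of x b] x b AV FV by blast
        then show False using nbF[OF x] False b by blast
      qed
    next
      assume "E x b" then show "x \<in> A" using False b VAF vert by blast
    qed
    then have "A = tri V E b b b"
      unfolding tri_def using AV irrefl by blast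
    then show ?thesis using b FV by blast
  next
    case True
    then obtain a b where ab: "a \<in> F" "b \<in> F" "E a b" by blast
    obtain u v x where uvx: "u \<in> F" "v \<in> F" "x \<in> F" "E u v" "x \<noteq> u"
      and leaf': "\<forall>y \<in> F. E v y \<longrightarrow> y = u"
      and leaves': "\<forall>y \<in> F. \<forall>z \<in> F. E u y \<and> y \<noteq> x \<and> E y z \<longrightarrow> z = u"
      by (rule acyc_leaf[OF FV F ab])
    from leaf' have leaf: "\<And>y. y \<in> F \<Longrightarrow> E v y \<Longrightarrow> y = u" by blast
    from leaves' have leaves: "\<And>y z. y \<in> F \<Longrightarrow> E u y \<Longrightarrow> y \<noteq> x \<Longrightarrow> z \<in> F \<Longrightarrow> E y z \<Longrightarrow> z = u" by blast
    have adj_u: "E w u" if w: "w \<in> A" "\<not> E w v" for w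
    proof -
      have "w \<noteq> v" using w uvx disj by blast
      then obtain z where "E w z" "E z v" using diam2[of w v] w uvx AV FV by blast
      then show ?thesis using nbF[OF w(1)] leaf sym by blast
    qed
    define Z where "Z = {z \<in> V. \<not> E z u \<and> \<not> E z v}"
    have ZF: "Z \<subseteq> F" using adj_u VAF unfolding Z_def by blast
    show ?thesis
    proof (cases "Z = {}")
      case True
      \<comment> \<open>A vertex of \<open>F\<close> other than \<open>u\<close> is not adjacent to
        the leaf \<open>v\<close>, so with \<open>Z\<close> empty it must be adjacent to
        \<open>u\<close>.\<close>
      have Fu: "E w u" if "w \<in> F" "w \<noteq> u" for w
        using that True leaf FV sym unfolding Z_def by blast
      have indF: "\<not> E w y" if "w \<in> F - {u}" "y \<in> F - {u}" for w y
      proof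
        assume e: "E w y"
        \<comment> \<open>An edge between \<open>w\<close> and \<open>y\<close> would close a
          triangle with \<open>u\<close>.\<close>
        have "min_deg2 E {u, w, y}"
          unfolding min_deg2_def
        proof (intro ballI)
          have d: "E w u" "E y u" "E u w" "E u y" "E y w" "w \<noteq> y" "w \<noteq> u" "y \<noteq> u"
            using e that Fu[of w] Fu[of y] sym irrefl by auto
          fix v assume "v \<in> {u, w, y}"
          then consider "v = u" | "v = w" | "v = y" by blast
          then show "\<exists>x \<in> {u, w, y}. \<exists>z \<in> {u, w, y}. x \<noteq> z \<and> E v x \<and> E v z"
            by cases (use d e in auto)
        qed
        moreover have "{u, w, y} \<subseteq> F" using that uvx by blast
        ultimately show False using F unfolding acyc_def by blast
      qed
      have eq: "V - {u} - A = F - {u}" unfolding F_def by blast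
      have "indep E A" "indep E (F - {u})" using indA indF unfolding indep_def by simp_all
      moreover have "A \<subseteq> V - {u}" using AV uvx(1) disj by blast
      ultimately have "star V E u A" unfolding star_def bipart_def eq using Fu by simp
      then show ?thesis using uvx FV by blast
    next
      case False
      then obtain z where z: "z \<in> Z" by blast
      have "w \<in> A \<longleftrightarrow> w \<in> tri V E u v x" for w
      proof
        assume w: "w \<in> A"
        have ne: "w \<noteq> u" "w \<noteq> v" "w \<noteq> x" using w uvx disj by blast+
        have "E w x \<or> (\<exists>z \<in> V. \<not> E z u \<and> \<not> E z v \<and> E w z)"
        proof (rule ccontr)
          assume no: "\<not> ?thesis"
          then have "\<not> E w z" "w \<noteq> z" using z ZF w disj unfolding Z_def by blast+
          then obtain y where y: "E w y" "E y z" using diam2[of w z] w z ZF AV FV by blast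
          have yF: "y \<in> F" using nbF w y by blast
          have zuv: "\<not> E z u" "\<not> E z v" "z \<in> F" using z ZF unfolding Z_def by auto
          have "y \<noteq> u" using y zuv sym by blast
          have "y \<in> V" "y \<noteq> x" using y no vert2 by blast+
          then have "E y u" using no y \<open>y \<noteq> u\<close> leaf yF sym by blast
          then have "z = u" using leaves yF \<open>y \<noteq> x\<close> zuv y sym by blast
          then show False using zuv uvx by blast
        qed
        then show "w \<in> tri V E u v x"
          unfolding tri_def using ne w AV adj_u by blast
      next
        assume "w \<in> tri V E u v x"
        then have w: "w \<in> V" "w \<noteq> u" "w \<noteq> v" "w \<noteq> x"
          and c: "E w v \<or> E w u \<and> (E w x \<or> (\<exists>z \<in> Z. E w z))"
          unfolding tri_def Z_def by blast+
        \<comment> \<open>If \<open>w\<close> were in \<open>F\<close>, it would be a neighbour of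
          \<open>u\<close> other than \<open>x\<close>, hence have \<open>u\<close> as its only
          neighbour in \<open>F\<close>. But the condition in \<open>tri\<close> provides
          \<open>x\<close> or a vertex of \<open>Z\<close> as a neighbour in \<open>F\<close>, and
          neither can be \<open>u\<close>.\<close>
        show "w \<in> A"
        proof (rule ccontr)
          assume "w \<notin> A"
          then have wF: "w \<in> F" using VAF w by blast
          have "\<not> E w v" using leaf wF w sym by blast
          with c have "E u w" and c2: "E w x \<or> (\<exists>z \<in> Z. E w z)" using sym by blast+
          with leaves wF w have "\<And>z. z \<in> F \<Longrightarrow> E w z \<Longrightarrow> z = u" by blast
          with c2 uvx ZF have "u \<in> Z" by blast
          then show False using uvx unfolding Z_def by blast
        qed
      qed
      then have "A = tri V E u v x" by blast
      then show ?thesis using uvx FV by blast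
    qed
  qed
qed

end

section \<open>Bipartitions of least cost\<close>

text \<open>With a large penalty \<open>c\<close>, a side \<open>B\<close> of minimum cost contains \<open>N\<close> whenever this is possible.\<close>

definition side_cost :: "'a set \<Rightarrow> nat \<Rightarrow> 'a set \<Rightarrow> 'a set \<Rightarrow> nat" where
  "side_cost N c K B = card (K \<inter> B) + c * card (K \<inter> N - B)"

lemma side_cost_Un:
  assumes "finite K" "finite L" "K \<inter> L = {}"
  shows "side_cost N c (K \<union> L) B = side_cost N c K B + side_cost N c L B"
proof -
  have "card ((K \<union> L) \<inter> B) = card (K \<inter> B) + card (L \<inter> B)"
    by (subst card_Un_disjoint[symmetric]) (use assms in \<open>auto simp: Int_Un_distrib2\<close>)
  moreover have "card ((K \<union> L) \<inter> N - B) = card (K \<inter> N - B) + card (L \<inter> N - B)"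
    by (subst card_Un_disjoint[symmetric]) (use assms in \<open>auto intro!: arg_cong[where f = card]\<close>)
  ultimately show ?thesis by (simp add: side_cost_def algebra_simps)
qed

lemma side_cost_cong:
  assumes "K \<inter> B = K \<inter> C" shows "side_cost N c K B = side_cost N c K C"
proof -
  have "K \<inter> N - B = K \<inter> N - C" using assms by blast
  with assms show ?thesis by (simp add: side_cost_def)
qed

text \<open>Records what walks force instead of the walks themselves: every bipartition of
  \<open>W\<close> puts \<open>P\<close> on the side of \<open>x\<close> and \<open>Q\<close> on the
  other side. If \<open>W\<close> has no bipartition this is vacuous, and \<open>P\<close> and
  \<open>Q\<close> may overlap.\<close>

definition confined :: "('a \<Rightarrow> 'a \<Rightarrow> bool) \<Rightarrow> 'a set \<Rightarrow> 'a \<Rightarrow> 'a set \<Rightarrow> 'a set \<Rightarrow> bool" where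
  "confined E W x P Q \<longleftrightarrow> x \<in> P \<and> P \<union> Q \<subseteq> W \<and>
     (\<forall>B. bipart E W B \<longrightarrow> (x \<in> B \<longrightarrow> P \<subseteq> B \<and> Q \<inter> B = {}) \<and> (x \<notin> B \<longrightarrow> Q \<subseteq> B \<and> P \<inter> B = {}))"

definition closed_under :: "('a \<Rightarrow> 'a \<Rightarrow> bool) \<Rightarrow> 'a set \<Rightarrow> 'a set \<Rightarrow> bool" where
  "closed_under E W K \<longleftrightarrow> (\<forall>i \<in> K. \<forall>j \<in> W. E i j \<longrightarrow> j \<in> K)"

text \<open>\<open>P\<close> and \<open>Q\<close> stand for the vertices reachable from \<open>x\<close> inside \<open>W\<close> by walks of even and odd
  length; only these properties of them are needed.\<close>

definition sides :: "('a \<Rightarrow> 'a \<Rightarrow> bool) \<Rightarrow> 'a set \<Rightarrow> 'a \<Rightarrow> 'a set \<Rightarrow> 'a set \<Rightarrow> bool" where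
  "sides E W x P Q \<longleftrightarrow> confined E W x P Q \<and> closed_under E W (P \<union> Q)"

text \<open>For disjoint \<open>P\<close> and \<open>Q\<close>, the two sums are the costs on
  \<open>P \<union> Q\<close> of choosing \<open>P\<close> and of choosing \<open>Q\<close>; a tie
  goes to \<open>P\<close>. The choice does not depend on \<open>B\<close>, so the same step can be
  applied to two sets in parallel.\<close>

definition recolour :: "'a set \<Rightarrow> nat \<Rightarrow> 'a set \<Rightarrow> 'a set \<Rightarrow> 'a set \<Rightarrow> 'a set" where
  "recolour N c P Q B =
     (if card P + c * card (Q \<inter> N) \<le> card Q + c * card (P \<inter> N) then B - Q \<union> P else B - P \<union> Q)"

text \<open>No edge inside \<open>W\<close> leaves \<open>P \<union> Q\<close>, and \<open>B\<close>
  meets this part in exactly \<open>P\<close> or \<open>Q\<close>. Recolouring therefore keeps or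
  swaps the two sides there, and since the cost is additive over this part and the rest of
  \<open>W\<close>, taking the cheaper side cannot raise the total.\<close>

lemma (in simple_graph) recolour_bipart:
  assumes W: "finite W" and PQ: "sides E W x P Q" and B: "bipart E W B"
  shows "bipart E W (recolour N c P Q B)"
    and "side_cost N c W (recolour N c P Q B) \<le> side_cost N c W B"
proof -
  let ?R = "recolour N c P Q B"
  define K where "K = P \<union> Q"
  have KW: "K \<subseteq> W" and closed: "\<And>i j. i \<in> K \<Longrightarrow> j \<in> W \<Longrightarrow> E i j \<Longrightarrow> j \<in> K"
    using PQ unfolding sides_def confined_def closed_under_def K_def by auto
  have BPQ: "K \<inter> B = P \<or> K \<inter> B = Q" and disj: "P \<inter> Q = {}"
    using PQ B unfolding sides_def confined_def closed_under_def K_def by blast+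
  have RPQ: "K \<inter> ?R = (if card P + c * card (Q \<inter> N) \<le> card Q + c * card (P \<inter> N) then P else Q)"
    using disj unfolding recolour_def K_def by auto
  have out: "w \<in> ?R \<longleftrightarrow> w \<in> B" if "w \<notin> K" for w
    using that unfolding recolour_def K_def by auto
  have same: "(\<forall>w \<in> K. w \<in> ?R \<longleftrightarrow> w \<in> B) \<or> (\<forall>w \<in> K. w \<in> ?R \<longleftrightarrow> w \<notin> B)"
    using RPQ BPQ disj unfolding K_def by (auto split: if_splits)
  have cross: "\<not> E i j" "\<not> E j i" if "i \<in> K" "j \<in> W" "j \<notin> K" for i j
    using that closed sym by blast+
  have RW: "?R \<subseteq> W" using KW B unfolding recolour_def K_def bipart_def by auto
  have *: "(i \<in> ?R \<longleftrightarrow> j \<in> ?R) \<Longrightarrow> \<not> E i j" if ij: "i \<in> W" "j \<in> W" for i j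
  proof -
    assume s: "i \<in> ?R \<longleftrightarrow> j \<in> ?R"
    consider "i \<in> K" "j \<in> K" | "i \<notin> K" "j \<notin> K" | "i \<in> K" "j \<notin> K" | "i \<notin> K" "j \<in> K" by blast
    then show "\<not> E i j"
    proof cases
      case 1
      then have "i \<in> B \<longleftrightarrow> j \<in> B" using s same by blast
      then show ?thesis using B ij unfolding bipart_def indep_def by blast
    next
      case 2
      then have "i \<in> B \<longleftrightarrow> j \<in> B" using s out by blast
      then show ?thesis using B ij unfolding bipart_def indep_def by blast
    qed (use cross ij in blast)+
  qed
  show "bipart E W ?R"
    unfolding bipart_def indep_def using RW * by blast
  have fK: "finite K" using KW W finite_subset by blast
  have PK: "K \<inter> P = P" "K \<inter> Q = Q" and KP: "K - P = Q" "K - Q = P"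
    using disj unfolding K_def by auto
  have dP: "side_cost N c K P = card P + c * card (Q \<inter> N)"
    and dQ: "side_cost N c K Q = card Q + c * card (P \<inter> N)"
  proof -
    have "K \<inter> N - P = Q \<inter> N" "K \<inter> N - Q = P \<inter> N" using KP by blast+
    then show "side_cost N c K P = card P + c * card (Q \<inter> N)"
      "side_cost N c K Q = card Q + c * card (P \<inter> N)"
      unfolding side_cost_def using PK by auto
  qed
  have "side_cost N c K B = side_cost N c K P \<or> side_cost N c K B = side_cost N c K Q"
    using BPQ PK side_cost_cong[of K B P] side_cost_cong[of K B Q] by auto
  moreover have "side_cost N c K ?R = min (side_cost N c K P) (side_cost N c K Q)"
    using RPQ PK side_cost_cong[of K ?R P N c] side_cost_cong[of K ?R Q N c] dP dQ
    by (auto split: if_splits)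
  ultimately have 1: "side_cost N c K ?R \<le> side_cost N c K B" by auto
  have 2: "side_cost N c (W - K) ?R = side_cost N c (W - K) B"
    by (rule side_cost_cong) (use out in blast)
  have WK: "W = K \<union> (W - K)" using KW by blast
  show "side_cost N c W ?R \<le> side_cost N c W B"
    using 1 2 side_cost_Un[of K "W - K" N c] fK W WK
    by (metis Diff_disjoint add_le_mono1 finite_Diff)
qed

text \<open>\<open>A\<close> pays no penalty and, omitting \<open>u\<close>, has fewer than
  \<open>card V\<close> elements, so its cost is below the price of one missing non-neighbour of
  \<open>u\<close>. A set \<open>B\<close> of no greater cost thus contains all of them, and its
  cost is its size as well.\<close>

lemma (in simple_graph) cheap_bipart_star:
  assumes u: "u \<in> V" and A: "star V E u A" and B: "bipart E (V - {u}) B"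
    and cost: "side_cost {w. \<not> E w u} (card V) (V - {u}) B \<le> side_cost {w. \<not> E w u} (card V) (V - {u}) A"
  shows "star V E u B" "card B \<le> card A"
proof -
  let ?N = "{w. \<not> E w u}"
  have AW: "A \<subseteq> V - {u}" and BW: "B \<subseteq> V - {u}" using A B unfolding star_def bipart_def by auto
  have eA: "(V - {u}) \<inter> ?N - A = {}" using A unfolding star_def by auto
  have cA: "side_cost ?N (card V) (V - {u}) A = card A"
    using AW unfolding side_cost_def eA by (simp add: Int_absorb1)
  have "card A < card V"
    using AW u finV by (intro psubset_card_mono) auto
  have cB: "side_cost ?N (card V) (V - {u}) B = card B + card V * card ((V - {u}) \<inter> ?N - B)"
    using BW unfolding side_cost_def by (simp add: Int_absorb1)
  have "card ((V - {u}) \<inter> ?N - B) = 0"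
    using cost \<open>card A < card V\<close> unfolding cA cB by (cases "card ((V - {u}) \<inter> ?N - B)") auto
  then have "(V - {u}) \<inter> ?N - B = {}" using finV by simp
  then show "star V E u B" using B unfolding star_def by blast
  show "card B \<le> card A" using cost unfolding cA cB by simp
qed

section \<open>Translation from the graph library\<close>

lemma cas_consecutive:
  assumes "pre_digraph.cas H u p v" "Suc i < length p"
  shows "head H (p ! i) = tail H (p ! Suc i)"
  using assms
proof (induction p arbitrary: u i)
  case (Cons e p)
  then show ?case
    by (cases i; cases p) (auto simp: pre_digraph.cas.simps)
qed simp

lemma cas_last:
  assumes "pre_digraph.cas H u p v" "p \<noteq> []"
  shows "tail H (p ! 0) = u" "head H (p ! (length p - 1)) = v"
  using assms
proof (induction p arbitrary: u)
  case (Cons e p)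
  { case 1 then show ?case by (simp add: pre_digraph.cas.simps)
  next
    case 2 then show ?case using Cons.IH by (cases p) (auto simp: pre_digraph.cas.simps) }
qed simp_all

text \<open>In a closed walk with at least three distinct vertices, the predecessor and the successor of
  each vertex are different.\<close>

lemma cycle_min_deg2:
  assumes p: "pre_digraph.cycle H p" "3 \<le> length p"
    and arcs: "\<And>e. e \<in> arcs H \<Longrightarrow> E (tail H e) (head H e)" and sym: "\<And>x y. E x y \<Longrightarrow> E y x"
  shows "min_deg2 E (head H ` set p)"
proof -
  define k where "k = length p"
  \<comment> \<open>Indices are reduced modulo \<open>k\<close>, so that predecessor and successor
    are given by one formula at every position of the cycle.\<close>
  define h where "h i = head H (p ! (i mod k))" for i
  obtain u where w: "pre_digraph.awalk H u p u"
    and d: "distinct (tl (pre_digraph.awalk_verts H u p))" and ne: "p \<noteq> []"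
    using p(1) unfolding pre_digraph.cycle_def by blast
  have k: "3 \<le> k" using p(2) by (simp add: k_def)
  have cas: "pre_digraph.cas H u p u" and pa: "set p \<subseteq> arcs H"
    using w unfolding pre_digraph.awalk_def by auto
  have "distinct (map (head H) p)"
    using d ne by (simp add: pre_digraph.awalk_verts_conv'[OF cas])
  then have inj: "h i = h j \<longleftrightarrow> i mod k = j mod k" for i j
  proof -
    have "i mod k < length p" "j mod k < length p" using ne unfolding k_def by simp_all
    with \<open>distinct (map (head H) p)\<close> show ?thesis
      unfolding h_def by (metis (no_types, lifting) length_map nth_eq_iff_index_eq nth_map)
  qed
  have succ: "tail H (p ! (Suc i mod k)) = h i" for i
  proof (cases "Suc (i mod k) = k")
    case True
    then have "Suc i mod k = 0" by (simp add: mod_Suc)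
    moreover from True have "i mod k = length p - 1" unfolding k_def by simp
    ultimately show ?thesis using cas_last[OF cas ne] unfolding h_def by metis
  next
    case False
    then have "Suc i mod k = Suc (i mod k)" by (simp add: mod_Suc)
    moreover have "Suc (i mod k) < length p"
      using False k mod_less_divisor[of k i] unfolding k_def by linarith
    ultimately show ?thesis using cas_consecutive[OF cas] unfolding h_def by metis
  qed
  have E: "E (h i) (h (Suc i))" for i
  proof -
    have "p ! (Suc i mod k) \<in> arcs H"
      using ne unfolding k_def by (intro subsetD[OF pa] nth_mem) simp
    then show ?thesis using arcs succ[of i] unfolding h_def by metis
  qed
  have img: "head H ` set p = range h"
  proof (intro equalityI subsetI)
    fix v assume "v \<in> head H ` set p"
    then obtain i where "i < k" "v = head H (p ! i)" unfolding k_def by (auto simp: in_set_conv_nth)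
    then have "v = h i" unfolding h_def by simp
    then show "v \<in> range h" by blast
  next
    fix v assume "v \<in> range h"
    then show "v \<in> head H ` set p" using ne unfolding h_def k_def by auto
  qed
  show ?thesis unfolding img min_deg2_def
  proof
    fix v assume "v \<in> range h"
    then obtain i where v: "v = h i" by blast
    \<comment> \<open>Position \<open>i + (k - 1)\<close> is the predecessor of \<open>i\<close>,
      written without subtracting from \<open>i\<close>. If it carried the same vertex as the
      successor, \<open>k\<close> would divide \<open>k - 2\<close>, which is impossible for
      \<open>k\<close> at least 3.\<close>
    have "h (i + (k - 1)) \<noteq> h (Suc i)"
    proof
      assume "h (i + (k - 1)) = h (Suc i)"
      then have "k dvd i + (k - 1) - Suc i"
        unfolding inj by (rule mod_eq_dvd_iff_nat[THEN iffD1, rotated]) (use k in simp)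
      then have "k dvd k - 2" by (simp add: numeral_2_eq_2)
      then have "k \<le> k - 2" using k by (intro dvd_imp_le) auto
      then show False using k by simp
    qed
    moreover have "h (Suc (i + (k - 1))) = h i" unfolding inj using k by simp
    then have "E (h i) (h (i + (k - 1)))" using E[of "i + (k - 1)"] sym by metis
    ultimately show "\<exists>x \<in> range h. \<exists>y \<in> range h. x \<noteq> y \<and> E v x \<and> E v y"
      unfolding v using E[of i] by blast
  qed
qed

section \<open>From minimum degree 2 to cycles\<close>

definition closed_arcs :: "'a list \<Rightarrow> ('a \<times> 'a) list" where
  "closed_arcs ys = zip ys (tl ys @ [hd ys])"

text \<open>The final vertex \<open>w\<close> is left free for the induction on \<open>ys\<close>;
  the value \<open>hd ys\<close> closes the walk.\<close>

lemma zip_tl_cas: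
  assumes "tail H = fst" "head H = snd" "ys \<noteq> []"
  shows "pre_digraph.cas H (hd ys) (zip ys (tl ys @ [w])) w"
  using assms(3)
proof (induction ys)
  case (Cons y ys)
  then show ?case using assms(1,2)
    by (cases ys) (auto simp: pre_digraph.cas.simps)
qed simp

lemma zip_tl_arcs:
  assumes "successively R ys" "ys \<noteq> []" "R (last ys) w" "e \<in> set (zip ys (tl ys @ [w]))"
  shows "R (fst e) (snd e)"
  using assms
proof (induction ys)
  case (Cons y ys)
  then show ?case by (cases ys) auto
qed simp

lemma successively_cycle:
  assumes H: "tail H = fst" "head H = snd" "arcs H = {(x, y). x \<in> verts H \<and> y \<in> verts H \<and> E x y}"
    and ys: "successively E ys" "distinct ys" "set ys \<subseteq> verts H" "ys \<noteq> []" "E (last ys) (hd ys)"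
  shows "pre_digraph.cycle H (closed_arcs ys)"
  unfolding pre_digraph.cycle_def
proof (intro exI[of _ "hd ys"] conjI)
  let ?p = "closed_arcs ys"
  have cas: "pre_digraph.cas H (hd ys) ?p (hd ys)"
    unfolding closed_arcs_def by (rule zip_tl_cas[OF H(1,2) ys(4)])
  have len: "length ys = length (tl ys @ [hd ys])" using ys(4) by simp
  show ne: "?p \<noteq> []" using ys(4) by (auto simp: closed_arcs_def zip_eq_Nil_iff)
  have sub: "set (tl ys @ [hd ys]) \<subseteq> set ys" using ys(4) by (cases ys) auto
  have "e \<in> arcs H" if e: "e \<in> set ?p" for e
  proof -
    have "E (fst e) (snd e)" using zip_tl_arcs[OF ys(1,4,5)] e unfolding closed_arcs_def .
    moreover have "fst e \<in> set ys" "snd e \<in> set (tl ys @ [hd ys])"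
      using e unfolding closed_arcs_def by (metis prod.collapse set_zip_leftD set_zip_rightD)+
    ultimately show ?thesis using H(3) ys(3) sub by (auto simp: case_prod_beta)
  qed
  then show "pre_digraph.awalk H (hd ys) ?p (hd ys)"
    unfolding pre_digraph.awalk_def using cas ys(3,4) hd_in_set by blast
  \<comment> \<open>Without its first entry, the vertex list of the walk is \<open>ys\<close>
    rotated by one place, so distinctness is inherited.\<close>
  have "tl (pre_digraph.awalk_verts H (hd ys) ?p) = tl ys @ [hd ys]"
    using ne pre_digraph.awalk_verts_conv'[OF cas] map_snd_zip[OF len]
    by (simp add: H(2) flip: closed_arcs_def)
  moreover have "distinct (tl ys @ [hd ys])" using ys(2,4) by (cases ys) auto
  ultimately show "distinct (tl (pre_digraph.awalk_verts H (hd ys) ?p))" by simp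
qed

text \<open>All neighbours of the first vertex of a longest path lie on the path.\<close>

lemma min_deg2_cycle_list:
  assumes S: "finite S" "min_deg2 E S" "S \<noteq> {}" and irrefl: "\<And>x. \<not> E x x"
    and sym: "\<And>x y. E x y \<Longrightarrow> E y x"
  obtains ys where "successively E ys" "distinct ys" "set ys \<subseteq> S" "3 \<le> length ys" "E (last ys) (hd ys)"
proof -
  define path where "path xs \<longleftrightarrow> successively E xs \<and> distinct xs \<and> set xs \<subseteq> S \<and> xs \<noteq> []" for xs
  obtain s where "s \<in> S" using S(3) by blast
  then have "path [s]" unfolding path_def by simp
  moreover have "length xs \<le> card S" if "path xs" for xs
    using that S(1) unfolding path_def by (metis card_mono distinct_card)
  ultimately obtain xs where xs: "path xs" and longest: "\<And>zs. path zs \<Longrightarrow> length zs \<le> length xs"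
    using ex_has_greatest_nat[of path "[s]" length "Suc (card S)"] by (metis less_Suc_eq_le)
  obtain x rest where Cons: "xs = x # rest" using xs unfolding path_def by (cases xs) auto
  have on: "y \<in> set rest" if "y \<in> S" "E x y" for y
  proof (rule ccontr)
    assume "y \<notin> set rest"
    then have "path (y # xs)" using xs that irrefl sym unfolding path_def Cons by auto
    then show False using longest by fastforce
  qed
  obtain y z where yz: "y \<in> S" "z \<in> S" "y \<noteq> z" "E x y" "E x z"
    using S(2) xs unfolding min_deg2_def path_def Cons by auto
  then obtain i j where ij: "i < length rest" "y = rest ! i" "j < length rest" "z = rest ! j"
    using on by (metis in_set_conv_nth)
  \<comment> \<open>Of two distinct positions in \<open>rest\<close>, the larger is at least 1. The
    path from \<open>x\<close> up to that neighbour of \<open>x\<close> has at least three vertices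
    and closes up.\<close>
  define m where "m = max i j"
  have "i \<noteq> j" using ij yz by blast
  then have m: "m < length rest" "E x (rest ! m)" "1 \<le> m"
    using ij yz unfolding m_def by (auto simp: max_def)
  show thesis
  proof (rule that[of "x # take (Suc m) rest"])
    have "x # rest = (x # take (Suc m) rest) @ drop (Suc m) rest" by simp
    then have "successively E ((x # take (Suc m) rest) @ drop (Suc m) rest)"
      using xs unfolding path_def Cons by metis
    then show "successively E (x # take (Suc m) rest)"
      unfolding successively_append_iff by blast
    show "distinct (x # take (Suc m) rest)" "set (x # take (Suc m) rest) \<subseteq> S"
      using xs unfolding path_def Cons by (auto dest: in_set_takeD)
    show "3 \<le> length (x # take (Suc m) rest)" using m by simp
    show "E (last (x # take (Suc m) rest)) (hd (x # take (Suc m) rest))"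
      using m sym by (simp add: take_Suc_conv_app_nth)
  qed
qed

text \<open>A longest path in a nonempty set of minimum degree 2 yields a cycle of length at least
  3; conversely, the vertices of such a cycle form a set of minimum degree 2.\<close>

lemma undirected_forest_iff_acyc:
  assumes H: "tail H = fst" "head H = snd" "arcs H = {(x, y). x \<in> verts H \<and> y \<in> verts H \<and> E x y}"
    and fin: "finite (verts H)" and irrefl: "\<And>x. \<not> E x x" and sym: "\<And>x y. E x y \<Longrightarrow> E y x"
  shows "undirected_forest H \<longleftrightarrow> acyc E (verts H)"
proof
  assume forest: "undirected_forest H"
  show "acyc E (verts H)" unfolding acyc_def
  proof (intro allI impI, rule ccontr)
    fix S assume S: "S \<subseteq> verts H" "min_deg2 E S" "S \<noteq> {}"
    then have "finite S" using fin finite_subset by blast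
    then obtain ys where ys: "successively E ys" "distinct ys" "set ys \<subseteq> S" "3 \<le> length ys"
      "E (last ys) (hd ys)"
      using min_deg2_cycle_list[OF _ S(2,3) irrefl sym] by blast
    then have "pre_digraph.cycle H (closed_arcs ys)"
      using S(1) by (intro successively_cycle[OF H]) auto
    moreover have "length (closed_arcs ys) = length ys" using ys(4) by (simp add: closed_arcs_def)
    ultimately show False using forest ys(4) unfolding undirected_forest_def by metis
  qed
next
  assume ac: "acyc E (verts H)"
  show "undirected_forest H" unfolding undirected_forest_def
  proof (intro notI, elim exE conjE)
    fix p assume p: "pre_digraph.cycle H p" "3 \<le> length p"
    have "min_deg2 E (head H ` set p)"
      by (rule cycle_min_deg2[OF p _ sym]) (use H in auto)
    moreover have "set p \<subseteq> arcs H"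
      using p(1) unfolding pre_digraph.cycle_def pre_digraph.awalk_def by blast
    then have "head H ` set p \<subseteq> verts H" using H(2,3) by auto
    ultimately have "head H ` set p = {}" using ac unfolding acyc_def by blast
    then show False using p(2) by simp
  qed
qed

section \<open>The input graph as an adjacency relation\<close>

lemma indep_fvs_iff_ifvs:
  assumes "pair_graph G"
  shows "indep_fvs (with_proj G) A \<longleftrightarrow> ifvs (pverts G) (\<lambda>x y. (x, y) \<in> parcs G) A"
proof -
  interpret pair_graph G by fact
  have "undirected_forest (with_proj G \<restriction> S) \<longleftrightarrow> acyc (\<lambda>x y. (x, y) \<in> parcs G) S" if "S \<subseteq> pverts G" for S
  proof -
    have "undirected_forest (with_proj G \<restriction> S) \<longleftrightarrow> acyc (\<lambda>x y. (x, y) \<in> parcs G) (verts (with_proj G \<restriction> S))"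
    proof (rule undirected_forest_iff_acyc)
      show "finite (verts (with_proj G \<restriction> S))"
        using finite_subset[OF that pair_finite_verts] by simp
      show "(x, x) \<notin> parcs G" for x using pair_no_loops by fastforce
      show "(y, x) \<in> parcs G" if "(x, y) \<in> parcs G" for x y
        using pair_sym_arcs that by (auto simp: symmetric_def dest: symD)
    qed auto
    then show ?thesis by simp
  qed
  then show ?thesis
    unfolding indep_fvs_def ifvs_def independent_in_def indep_def by auto
qed

lemma diam2_graph_of_diameter:
  assumes "pair_graph G" and d: "graph_diameter (with_proj G) = 2"
  shows "diam2_graph (pverts G) (\<lambda>x y. (x, y) \<in> parcs G)"
proof -
  interpret pair_graph G by fact
  have irrefl: "(x, x) \<notin> parcs G" for x using pair_no_loops by fastforce
  have le2: "\<mu> (\<lambda>_. 1) u v \<le> 2" if "u \<in> pverts G" "v \<in> pverts G" for u v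
  proof -
    have "\<mu> (\<lambda>_. 1) u v \<le> (SUP v \<in> pverts G. \<mu> (\<lambda>_. 1) u v)" using that by (intro SUP_upper)
    also have "\<dots> \<le> (SUP u \<in> pverts G. SUP v \<in> pverts G. \<mu> (\<lambda>_. 1) u v)" using that by (intro SUP_upper)
    also have "\<dots> = 2" using d unfolding graph_diameter_def by simp
    finally show ?thesis .
  qed
  have cost: "awalk_cost (\<lambda>_. 1) p = real (length p)" for p
    by (induction p) auto
  have nbr: "\<exists>z. (u, z) \<in> parcs G \<and> (z, v) \<in> parcs G"
    if uv: "u \<in> pverts G" "v \<in> pverts G" "u \<noteq> v" "(u, v) \<notin> parcs G" for u v
  proof -
    \<comment> \<open>The distance is an infimum over walks: a value strictly below 3 yields a walk
      of cost below 3, hence with at most two arcs. As \<open>u\<close> and \<open>v\<close> are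
      distinct and not adjacent, it has exactly two.\<close>
    have "\<mu> (\<lambda>_. 1) u v < 3" using le2[OF uv(1,2)] by (rule le_less_trans) simp
    then obtain p where p: "awalk u p v" "ereal (awalk_cost (\<lambda>_. 1) p) < 3"
      unfolding \<mu>_def INF_less_iff by blast
    have "length p < 3" using p(2) unfolding cost by simp
    with p(1) uv(3,4) show ?thesis
      unfolding awalk_def
      by (cases p; cases "tl p"; cases "tl (tl p)") auto
  qed
  \<comment> \<open>With at most one vertex the diameter could not exceed 0. Two distinct vertices
    are adjacent or have a common neighbour, so the graph has an edge.\<close>
  have "\<exists>u \<in> pverts G. \<exists>v \<in> pverts G. u \<noteq> v"
  proof (rule ccontr)
    assume no: "\<not> ?thesis"
    have "graph_diameter (with_proj G) \<le> 0"
      unfolding graph_diameter_def with_proj_simps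
    proof (intro SUP_least)
      fix u v assume "u \<in> pverts G" "v \<in> pverts G"
      then have "awalk u [] v" using no unfolding awalk_def by auto
      then have "\<mu> (\<lambda>_. 1) u v \<le> awalk_cost (\<lambda>_. 1) []" by (rule min_cost_le_walk_cost)
      then show "\<mu> (\<lambda>_. 1) u v \<le> 0" by (simp add: zero_ereal_def)
    qed
    then show False using d by simp
  qed
  then have "\<exists>x y. (x, y) \<in> parcs G" using nbr by blast
  moreover have "(y, x) \<in> parcs G" if "(x, y) \<in> parcs G" for x y
    using pair_sym_arcs that by (auto simp: symmetric_def dest: symD)
  ultimately show ?thesis
    using nbr irrefl pair_finite_verts by unfold_locales (auto dest: in_arcsD1)
qed

section \<open>Programs with bounded loops\<close>

text \<open>Every loop \<open>For i c\<close> runs \<open>i\<close> through the \<open>n\<close> vertices and does not write to \<open>i\<close> or \<open>n\<close> in its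
  body, so that the running time is bounded by a polynomial read off from the syntax.\<close>

datatype prog =
    Nop
  | Put vname exp exp
  | Then prog prog  (infixr ";;" 60)
  | Ite test prog prog
  | For vname prog

abbreviation var :: "vname \<Rightarrow> exp" where "var x \<equiv> Cell x (Num 0)"

primrec compile :: "prog \<Rightarrow> com" where
  "compile Nop = Skip"
| "compile (Put x i e) = Store x i e"
| "compile (c ;; d) = Seq (compile c) (compile d)"
| "compile (Ite b c d) = Cond b (compile c) (compile d)"
| "compile (For i c) = Seq (Store i (Num 0) (Num 0))
     (While (Less (var i) (var ''n'')) (Seq (compile c) (Store i (Num 0) (Add (var i) (Num 1)))))"

primrec writes :: "prog \<Rightarrow> vname set" where
  "writes Nop = {}"
| "writes (Put x i e) = {x}"
| "writes (c ;; d) = writes c \<union> writes d"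
| "writes (Ite b c d) = writes c \<union> writes d"
| "writes (For i c) = insert i (writes c)"

primrec bounded :: "prog \<Rightarrow> bool" where
  "bounded Nop \<longleftrightarrow> True"
| "bounded (Put x i e) \<longleftrightarrow> True"
| "bounded (c ;; d) \<longleftrightarrow> bounded c \<and> bounded d"
| "bounded (Ite b c d) \<longleftrightarrow> bounded c \<and> bounded d"
| "bounded (For i c) \<longleftrightarrow> bounded c \<and> i \<notin> writes c"

text \<open>A loop costs 4 steps for initialising its counter and 6 for the final failing test; each
  round adds 6 for the successful test and 7 for sequencing and incrementing. The two branches of
  \<open>Ite\<close> are added in place of a maximum.\<close>

primrec time_poly :: "prog \<Rightarrow> nat poly" where
  "time_poly Nop = [:1:]"
| "time_poly (Put x i e) = [:1 + exp_cost i + exp_cost e:]"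
| "time_poly (c ;; d) = [:1:] + time_poly c + time_poly d"
| "time_poly (Ite b c d) = [:1 + test_cost b:] + time_poly c + time_poly d"
| "time_poly (For i c) = [:10:] + [:0, 1:] * (time_poly c + [:13:])"

definition set_var :: "vname \<Rightarrow> nat \<Rightarrow> state \<Rightarrow> state" where
  "set_var x k s = s(x := (s x)(0 := k))"

lemma set_var_simps [simp]:
  "set_var x k s x 0 = k" "y \<noteq> x \<Longrightarrow> set_var x k s y = s y"
  by (simp_all add: set_var_def)

text \<open>The counter is assigned outright after each round, so \<open>iter_counter\<close> holds
  for every \<open>f\<close>. This agrees with the compiled increment when the body leaves the
  counter alone, as \<open>bounded\<close> demands.\<close>

primrec iter :: "(state \<Rightarrow> state) \<Rightarrow> vname \<Rightarrow> nat \<Rightarrow> state \<Rightarrow> state" where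
  "iter f i 0 s = set_var i 0 s"
| "iter f i (Suc k) s = set_var i (Suc k) (f (iter f i k s))"

primrec sem :: "prog \<Rightarrow> state \<Rightarrow> state" where
  "sem Nop s = s"
| "sem (Put x i e) s = s(x := (s x)(exp_val i s := exp_val e s))"
| "sem (c ;; d) s = sem d (sem c s)"
| "sem (Ite b c d) s = (if test_val b s then sem c s else sem d s)"
| "sem (For i c) s = iter (sem c) i (s ''n'' 0) s"

lemma iter_frame:
  assumes "\<And>t. f t x = t x" "x \<noteq> i"
  shows "iter f i k s x = s x"
  using assms by (induction k) simp_all

lemma iter_counter: "iter f i k s i 0 = k"
  by (cases k) simp_all

lemma sem_frame: "x \<notin> writes c \<Longrightarrow> sem c s x = s x"
proof (induction c arbitrary: s)
  case (For i c)
  then show ?case by (simp add: iter_frame)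
qed auto

lemma compile_runs:
  assumes "bounded c" "''n'' \<notin> writes c" "s ''n'' 0 = n"
  shows "\<exists>t \<le> poly (time_poly c) n. runs (compile c) s t (sem c s)"
  using assms
proof (induction c arbitrary: s)
  case Nop
  then show ?case using runs.Skip by auto
next
  case (Put x i e)
  show ?case using runs.Store[of x i e s] by (intro exI[of _ "1 + exp_cost i + exp_cost e"]) (simp del: fun_upd_apply)
next
  case (Then c d)
  have "sem c s ''n'' 0 = n" using Then.prems by (simp add: sem_frame)
  with Then obtain t u where "t \<le> poly (time_poly c) n" "runs (compile c) s t (sem c s)"
    "u \<le> poly (time_poly d) n" "runs (compile d) (sem c s) u (sem d (sem c s))"
    by (metis UnI1 UnI2 bounded.simps(3) writes.simps(3))
  then show ?case using runs.Seq by (intro exI[of _ "1 + t + u"]) auto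
next
  case (Ite b c d)
  show ?case
  proof (cases "test_val b s")
    case True
    with Ite obtain t where "t \<le> poly (time_poly c) n" "runs (compile c) s t (sem c s)" by fastforce
    with True show ?thesis using runs.CondTrue by (intro exI[of _ "1 + test_cost b + t"]) auto
  next
    case False
    with Ite obtain t where "t \<le> poly (time_poly d) n" "runs (compile d) s t (sem d s)" by fastforce
    with False show ?thesis using runs.CondFalse by (intro exI[of _ "1 + test_cost b + t"]) auto
  qed
next
  case (For i c)
  let ?b = "Less (var i) (var ''n'')" and ?inc = "Store i (Num 0) (Add (var i) (Num 1))"
  let ?st = "\<lambda>k. iter (sem c) i k s" and ?T = "poly (time_poly c) n + 13"
  have n: "?st k ''n'' 0 = n" for k
    using For.prems by (simp add: iter_frame sem_frame)
  have inc: "?st k i 0 = k" and body: "sem c (?st k) i 0 = k" for k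
    using For.prems by (simp_all add: iter_counter sem_frame)
  \<comment> \<open>Induction from \<open>k = n\<close> downwards: 6 pays for the failing test, and
    \<open>?T\<close> for each of the \<open>n - k\<close> remaining rounds.\<close>
  have "\<exists>t \<le> 6 + (n - k) * ?T. runs (While ?b (Seq (compile c) ?inc)) (?st k) t (?st n)" if "k \<le> n" for k
    using that
  proof (induction k rule: inc_induct)
    case base
    have "\<not> test_val ?b (?st n)" using n inc by simp
    from runs.WhileFalse[OF this] show ?case by (intro exI[of _ "1 + test_cost ?b"]) simp
  next
    case (step k)
    obtain t where t: "t \<le> poly (time_poly c) n" "runs (compile c) (?st k) t (sem c (?st k))"
      using For.IH[of "?st k"] For.prems n by auto
    obtain u where u: "u \<le> 6 + (n - Suc k) * ?T" "runs (While ?b (Seq (compile c) ?inc)) (?st (Suc k)) u (?st n)"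
      using step.IH by blast
    have "runs ?inc (sem c (?st k)) (1 + 1 + 4) (?st (Suc k))"
      using runs.Store[of i "Num 0" "Add (var i) (Num 1)" "sem c (?st k)"] body[of k]
      by (simp add: set_var_def numeral_eq_Suc)
    note runs.Seq[OF t(2) this]
    moreover have "test_val ?b (?st k)" using n inc step.hyps by simp
    ultimately have "runs (While ?b (Seq (compile c) ?inc)) (?st k)
      (1 + test_cost ?b + (1 + t + (1 + 1 + 4)) + u) (?st n)"
      using u(2) runs.WhileTrue by blast
    moreover have "n - k = Suc (n - Suc k)" using step.hyps by simp
    then have "1 + test_cost ?b + (1 + t + (1 + 1 + 4)) + u \<le> 6 + (n - k) * ?T"
      using t(1) u(1) by simp
    ultimately show ?case by blast
  qed
  from this[of 0] obtain t where t: "t \<le> 6 + n * ?T"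
    "runs (While ?b (Seq (compile c) ?inc)) (set_var i 0 s) t (?st n)" by auto
  have "runs (Store i (Num 0) (Num 0)) s (1 + 1 + 1) (set_var i 0 s)"
    using runs.Store[of i "Num 0" "Num 0" s] by (simp add: set_var_def)
  from runs.Seq[OF this t(2)] show ?case
    using t(1) For.prems(3) by (intro exI[of _ "1 + (1 + 1 + 1) + t"]) (auto simp: algebra_simps)
qed

text \<open>The step hypothesis supplies the value of the counter and a frame condition for all
  unwritten arrays, so that \<open>I\<close> need only speak of what the body changes.\<close>

lemma sem_For_inv:
  assumes "I 0 (set_var i 0 s)"
    and "\<And>k t. k < s ''n'' 0 \<Longrightarrow> t i 0 = k \<Longrightarrow> (\<And>x. x \<notin> writes (For i c) \<Longrightarrow> t x = s x) \<Longrightarrow> I k t \<Longrightarrow>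
      I (Suc k) (set_var i (Suc k) (sem c t))"
  shows "I (s ''n'' 0) (sem (For i c) s)"
proof -
  have "I k (iter (sem c) i k s)" if "k \<le> s ''n'' 0" for k
    using that
  proof (induction k)
    case (Suc k)
    show ?case
      unfolding iter.simps
      by (rule assms(2)) (use Suc in \<open>auto simp: iter_counter iter_frame sem_frame\<close>)
  qed (use assms(1) in simp)
  then show ?thesis by simp
qed

lemma sem_For_flag:
  assumes "f \<noteq> i"
    and "\<And>k t. k < s ''n'' 0 \<Longrightarrow> t i 0 = k \<Longrightarrow> (\<And>x. x \<notin> writes (For i c) \<Longrightarrow> t x = s x) \<Longrightarrow>
      0 < sem c t f 0 \<longleftrightarrow> 0 < t f 0 \<or> B k"
  shows "0 < sem (For i c) s f 0 \<longleftrightarrow> 0 < s f 0 \<or> (\<exists>k < s ''n'' 0. B k)"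
  by (rule sem_For_inv[where I = "\<lambda>k t. 0 < t f 0 \<longleftrightarrow> 0 < s f 0 \<or> (\<exists>m < k. B m)"])
    (use assms in \<open>auto simp: less_Suc_eq\<close>)

lemma sem_For_sum:
  assumes "f \<noteq> i"
    and "\<And>k t. k < s ''n'' 0 \<Longrightarrow> t i 0 = k \<Longrightarrow> (\<And>x. x \<notin> writes (For i c) \<Longrightarrow> t x = s x) \<Longrightarrow>
      sem c t f 0 = t f 0 + g k"
  shows "sem (For i c) s f 0 = s f 0 + (\<Sum>k < s ''n'' 0. g k)"
  by (rule sem_For_inv[where I = "\<lambda>k t. t f 0 = s f 0 + (\<Sum>m < k. g m)"]) (use assms in auto)

text \<open>Each round writes only its own cell, so cell \<open>k\<close> is reached with its
  initial content and \<open>g k\<close> may depend on it, as in a conditional update.\<close>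

lemma sem_For_map:
  assumes "a \<noteq> i"
    and "\<And>k t. k < s ''n'' 0 \<Longrightarrow> t i 0 = k \<Longrightarrow> (\<And>x. x \<notin> writes (For i c) \<Longrightarrow> t x = s x) \<Longrightarrow>
      t a k = s a k \<Longrightarrow> sem c t a = (t a)(k := g k)"
  shows "sem (For i c) s a = (\<lambda>m. if m < s ''n'' 0 then g m else s a m)"
  by (rule sem_For_inv[where I = "\<lambda>k t. t a = (\<lambda>m. if m < k then g m else s a m)"])
    (use assms in \<open>auto simp: fun_eq_iff less_Suc_eq\<close>)

section \<open>The algorithm\<close>

abbreviation cell :: "vname \<Rightarrow> vname \<Rightarrow> exp" where "cell a i \<equiv> Cell a (var i)"
abbreviation put :: "vname \<Rightarrow> exp \<Rightarrow> prog" where "put x e \<equiv> Put x (Num 0) e"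
abbreviation put_at :: "vname \<Rightarrow> vname \<Rightarrow> exp \<Rightarrow> prog" where "put_at a i e \<equiv> Put a (var i) e"
abbreviation nz :: "exp \<Rightarrow> test" where "nz e \<equiv> Less (Num 0) e"
abbreviation disj :: "test \<Rightarrow> test \<Rightarrow> test" where "disj b c \<equiv> Neg (Conj (Neg b) (Neg c))"

definition neq :: "vname \<Rightarrow> vname \<Rightarrow> test" where
  "neq i j = disj (Less (var i) (var j)) (Less (var j) (var i))"

text \<open>There is no multiplication; \<open>row[i]\<close> holds the offset \<open>i * n\<close> of row \<open>i\<close> of the matrix.\<close>

definition edge :: "vname \<Rightarrow> vname \<Rightarrow> test" where
  "edge i j = nz (Cell ''adj'' (Add (cell ''row'' i) (var j)))"

text \<open>Relies on \<open>row[0]\<close> being 0 in the initial state; later offsets arise by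
  repeated addition.\<close>

definition init_rows :: prog where
  "init_rows = For ''i'' (Put ''row'' (Add (var ''i'') (Num 1)) (Add (cell ''row'' ''i'') (var ''n'')))"

definition indep_step :: prog where
  "indep_step = Ite (Conj (nz (cell ''c'' ''i'')) (Conj (nz (cell ''c'' ''j'')) (edge ''i'' ''j'')))
     (put ''bad'' (Num 1)) Nop"

definition check_indep :: prog where
  "check_indep = put ''bad'' (Num 0) ;; For ''i'' (For ''j'' indep_step)"

definition deg_step :: prog where
  "deg_step = Ite (Conj (Neg (nz (cell ''rem'' ''j''))) (edge ''i'' ''j''))
     (put ''deg'' (Add (var ''deg'') (Num 1))) Nop"

definition strip_step :: prog where
  "strip_step = put ''deg'' (Num 0) ;; For ''j'' deg_step ;;
     Ite (Less (var ''deg'') (Num 2)) (put_at ''rem'' ''i'' (Num 1)) Nop"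

definition strip_round :: prog where
  "strip_round = For ''i'' strip_step"

definition check_forest :: prog where
  "check_forest = For ''i'' (put_at ''rem'' ''i'' (cell ''c'' ''i'')) ;; For ''r'' strip_round ;;
     For ''i'' (Ite (nz (cell ''rem'' ''i'')) Nop (put ''bad'' (Num 1)))"

definition keep_best :: prog where
  "keep_best = put ''size'' (Num 0) ;;
     For ''i'' (Ite (nz (cell ''c'' ''i'')) (put ''size'' (Add (var ''size'') (Num 1))) Nop) ;;
     Ite (Conj (Neg (nz (var ''bad''))) (disj (Neg (nz (var ''found''))) (Less (var ''size'') (var ''best''))))
       (put ''found'' (Num 1) ;; put ''best'' (var ''size'') ;;
        For ''i'' (put_at ''set'' ''i'' (cell ''c'' ''i''))) Nop"

definition try_candidate :: prog where
  "try_candidate = check_indep ;; check_forest ;; keep_best"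

definition tri_flag :: prog where
  "tri_flag = Ite (Conj (Neg (edge ''z'' ''u'')) (Conj (Neg (edge ''z'' ''v'')) (edge ''w'' ''z'')))
     (put ''f'' (Num 1)) Nop"

definition tri_step :: prog where
  "tri_step = put ''f'' (Num 0) ;; For ''z'' tri_flag ;;
     Ite (Conj (neq ''w'' ''u'') (Conj (neq ''w'' ''v'') (Conj (neq ''w'' ''x'')
         (disj (edge ''w'' ''v'') (Conj (edge ''w'' ''u'') (disj (edge ''w'' ''x'') (nz (var ''f''))))))))
       (put_at ''c'' ''w'' (Num 1)) (put_at ''c'' ''w'' (Num 0))"

definition make_tri :: prog where
  "make_tri = For ''w'' tri_step"

definition reach_step :: prog where
  "reach_step = Ite (Conj (neq ''i'' ''u'') (Conj (neq ''j'' ''u'') (edge ''i'' ''j'')))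
     (Ite (nz (cell ''p'' ''i'')) (put_at ''q'' ''j'' (Num 1)) Nop ;;
      Ite (nz (cell ''q'' ''i'')) (put_at ''p'' ''j'' (Num 1)) Nop) Nop"

definition reach_round :: prog where
  "reach_round = For ''i'' (For ''j'' reach_step)"

definition make_sides :: prog where
  "make_sides = For ''w'' (put_at ''p'' ''w'' (Num 0)) ;; For ''w'' (put_at ''q'' ''w'' (Num 0)) ;;
     put_at ''p'' ''x'' (Num 1) ;; For ''r'' reach_round"

text \<open>\<open>a\<close> accumulates the cost of choosing the side \<open>p\<close>, and
  \<open>b\<close> that of choosing \<open>q\<close>. A vertex not adjacent to \<open>u\<close>
  charges the penalty \<open>n\<close> to the choice that would omit it.\<close>

definition cost_step :: prog where
  "cost_step =
     Ite (nz (cell ''p'' ''w'')) (put ''a'' (Add (var ''a'') (Num 1)) ;;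
       Ite (edge ''w'' ''u'') Nop (put ''b'' (Add (var ''b'') (var ''n'')))) Nop ;;
     Ite (nz (cell ''q'' ''w'')) (put ''b'' (Add (var ''b'') (Num 1)) ;;
       Ite (edge ''w'' ''u'') Nop (put ''a'' (Add (var ''a'') (var ''n'')))) Nop"

definition choose_step :: "vname \<Rightarrow> vname \<Rightarrow> prog" where
  "choose_step p q = Ite (nz (cell p ''w'')) (put_at ''c'' ''w'' (Num 1))
     (Ite (nz (cell q ''w'')) (put_at ''c'' ''w'' (Num 0)) Nop)"

definition recolour_prog :: prog where
  "recolour_prog = put ''a'' (Num 0) ;; put ''b'' (Num 0) ;; For ''w'' cost_step ;;
     Ite (Neg (Less (var ''b'') (var ''a'')))
       (For ''w'' (choose_step ''p'' ''q'')) (For ''w'' (choose_step ''q'' ''p''))"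

text \<open>A component is recoloured from each of its vertices in turn, which saves recording the
  components already treated.\<close>

definition star_step :: prog where
  "star_step = Ite (neq ''x'' ''u'') (make_sides ;; recolour_prog) Nop"

definition make_star :: prog where
  "make_star = For ''w'' (put_at ''c'' ''w'' (Num 0)) ;; For ''x'' star_step"

definition min_ifvs_prog :: prog where
  "min_ifvs_prog = init_rows ;;
     For ''u'' (For ''v'' (For ''x'' (make_tri ;; try_candidate))) ;;
     For ''u'' (make_star ;; try_candidate)"

lemmas prog_defs = init_rows_def indep_step_def check_indep_def deg_step_def strip_step_def strip_round_def
  check_forest_def keep_best_def try_candidate_def tri_flag_def tri_step_def make_tri_def reach_step_def
  reach_round_def make_sides_def cost_step_def choose_step_def recolour_prog_def star_step_def make_star_def
  min_ifvs_prog_def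

lemma min_ifvs_prog_bounded: "bounded min_ifvs_prog" "''n'' \<notin> writes min_ifvs_prog"
  by (simp_all add: prog_defs)

section \<open>Correctness\<close>

definition stores_graph :: "nat \<Rightarrow> (nat \<Rightarrow> nat \<Rightarrow> bool) \<Rightarrow> state \<Rightarrow> bool" where
  "stores_graph n E s \<longleftrightarrow> s ''n'' 0 = n \<and>
     (\<forall>i < n. \<forall>j < n. 0 < s ''adj'' (s ''row'' i + j) \<longleftrightarrow> E i j)"

lemma stores_graph_cong:
  "\<lbrakk>stores_graph n E s; t ''n'' = s ''n''; t ''adj'' = s ''adj''; t ''row'' = s ''row''\<rbrakk> \<Longrightarrow> stores_graph n E t"
  by (simp add: stores_graph_def)

lemma stores_graph_n: "stores_graph n E s \<Longrightarrow> s ''n'' 0 = n"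
  by (simp add: stores_graph_def)

lemma edge_val:
  "\<lbrakk>stores_graph n E s; s i 0 < n; s j 0 < n\<rbrakk> \<Longrightarrow> test_val (edge i j) s \<longleftrightarrow> E (s i 0) (s j 0)"
  by (simp add: stores_graph_def edge_def)

lemma neq_val [simp]: "test_val (neq i j) s \<longleftrightarrow> s i 0 \<noteq> s j 0"
  by (auto simp: neq_def)

definition members :: "nat \<Rightarrow> vname \<Rightarrow> state \<Rightarrow> nat set" where
  "members n a s = {w. w < n \<and> 0 < s a w}"

lemma init_rows_spec:
  assumes "s ''row'' 0 = 0" "m \<le> s ''n'' 0"
  shows "sem init_rows s ''row'' m = m * s ''n'' 0"
proof -
  have "\<forall>m \<le> s ''n'' 0. sem init_rows s ''row'' m = m * s ''n'' 0"
    unfolding init_rows_def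
    by (rule sem_For_inv[where I = "\<lambda>k t. \<forall>m \<le> k. t ''row'' m = m * s ''n'' 0"])
      (use assms in \<open>auto simp: le_Suc_eq\<close>)
  with assms(2) show ?thesis by blast
qed

section \<open>Testing a candidate and recording the best one\<close>

lemma check_indep_spec:
  assumes g: "stores_graph n E s"
  shows "0 < sem check_indep s ''bad'' 0 \<longleftrightarrow> \<not> indep E (members n ''c'' s)"
proof -
  let ?s = "sem (put ''bad'' (Num 0)) s"
  have n: "?s ''n'' 0 = n" using g by (simp add: stores_graph_n)
  have "0 < sem (For ''i'' (For ''j'' indep_step)) ?s ''bad'' 0 \<longleftrightarrow>
    0 < ?s ''bad'' 0 \<or> (\<exists>i < ?s ''n'' 0. \<exists>j < n. 0 < s ''c'' i \<and> 0 < s ''c'' j \<and> E i j)"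
  proof (rule sem_For_flag, simp)
    fix i t assume i: "i < ?s ''n'' 0" "t ''i'' 0 = i"
      and fr: "\<And>x. x \<notin> writes (For ''i'' (For ''j'' indep_step)) \<Longrightarrow> t x = ?s x"
    have tn: "t ''n'' 0 = n" using n by (simp add: fr indep_step_def)
    have "0 < sem (For ''j'' indep_step) t ''bad'' 0 \<longleftrightarrow>
      0 < t ''bad'' 0 \<or> (\<exists>j < t ''n'' 0. 0 < s ''c'' i \<and> 0 < s ''c'' j \<and> E i j)"
    proof (rule sem_For_flag, simp)
      fix j t' assume j: "j < t ''n'' 0" "t' ''j'' 0 = j"
        and fr': "\<And>x. x \<notin> writes (For ''j'' indep_step) \<Longrightarrow> t' x = t x"
      have g': "stores_graph n E t'"
        by (rule stores_graph_cong[OF g]) (simp_all add: fr fr' indep_step_def)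
      show "0 < sem indep_step t' ''bad'' 0 \<longleftrightarrow>
        0 < t' ''bad'' 0 \<or> 0 < s ''c'' i \<and> 0 < s ''c'' j \<and> E i j"
        using i j n tn by (simp add: indep_step_def edge_val[OF g'] fr fr')
    qed
    then show "0 < sem (For ''j'' indep_step) t ''bad'' 0 \<longleftrightarrow>
      0 < t ''bad'' 0 \<or> (\<exists>j < n. 0 < s ''c'' i \<and> 0 < s ''c'' j \<and> E i j)"
      unfolding tn .
  qed
  then show ?thesis
    using n unfolding check_indep_def indep_def members_def by auto
qed

lemma sum_indicator: "(\<Sum>k < n. if P k then 1 else 0) = card {k :: nat. k < n \<and> P k}"
  by (simp flip: sum.inter_filter)

lemma two_le_card_iff: "finite S \<Longrightarrow> 2 \<le> card S \<longleftrightarrow> (\<exists>x \<in> S. \<exists>y \<in> S. x \<noteq> y)"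
  using card_le_Suc0_iff_eq[of S] by (auto simp: numeral_2_eq_2 not_less_eq_eq[symmetric])

definition live :: "nat \<Rightarrow> state \<Rightarrow> nat set" where
  "live n s = {w. w < n \<and> s ''rem'' w = 0}"

lemma strip_step_spec:
  assumes g: "stores_graph n E s" and i: "s ''i'' 0 = i" "i < n"
  shows "live n (sem strip_step s) =
    (if \<exists>x \<in> live n s. \<exists>y \<in> live n s. x \<noteq> y \<and> E i x \<and> E i y then live n s else live n s - {i})"
proof -
  let ?s = "sem (put ''deg'' (Num 0)) s" and ?s' = "sem (For ''j'' deg_step) (sem (put ''deg'' (Num 0)) s)"
  have n: "?s ''n'' 0 = n" using g by (simp add: stores_graph_n)
  have "?s' ''deg'' 0 = ?s ''deg'' 0 + (\<Sum>j < ?s ''n'' 0. if s ''rem'' j = 0 \<and> E i j then 1 else 0)"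
  proof (rule sem_For_sum, simp)
    fix j t assume j: "j < ?s ''n'' 0" "t ''j'' 0 = j"
      and fr: "\<And>x. x \<notin> writes (For ''j'' deg_step) \<Longrightarrow> t x = ?s x"
    have g': "stores_graph n E t"
      by (rule stores_graph_cong[OF g]) (simp_all add: fr deg_step_def)
    show "sem deg_step t ''deg'' 0 = t ''deg'' 0 + (if s ''rem'' j = 0 \<and> E i j then 1 else 0)"
      using i j n by (simp add: deg_step_def edge_val[OF g'] fr)
  qed
  also have "\<dots> = card {j \<in> live n s. E i j}"
    unfolding n sum_indicator live_def by (simp add: conj_assoc)
  finally have two: "?s' ''deg'' 0 < 2 \<longleftrightarrow> \<not> (\<exists>x \<in> live n s. \<exists>y \<in> live n s. x \<noteq> y \<and> E i x \<and> E i y)"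
    using two_le_card_iff[of "{j \<in> live n s. E i j}"] by (fastforce simp: live_def)
  have "sem strip_step s ''rem'' = (if ?s' ''deg'' 0 < 2 then (s ''rem'')(i := 1) else s ''rem'')"
    using i unfolding strip_step_def by (simp add: sem_frame deg_step_def del: sem.simps(5))
  then have "live n (sem strip_step s) = (if ?s' ''deg'' 0 < 2 then live n s - {i} else live n s)"
    using i unfolding live_def by auto
  then show ?thesis unfolding two by argo
qed

text \<open>A vertex is removed only when it has fewer than two live neighbours, so it belongs to no
  live subset of minimum degree 2. Removals are never undone; if a round leaves the live set
  unchanged, every live vertex was tested against that same set and passed.\<close>

lemma strip_round_spec:
  assumes g: "stores_graph n E s"
  shows "live n (sem strip_round s) \<subseteq> live n s"
    and "\<forall>S \<subseteq> live n s. min_deg2 E S \<longrightarrow> S \<subseteq> live n (sem strip_round s)"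
    and "live n (sem strip_round s) = live n s \<Longrightarrow> min_deg2 E (live n s)"
proof -
  define two where "two k R \<longleftrightarrow> (\<exists>x \<in> R. \<exists>y \<in> R. x \<noteq> y \<and> E k x \<and> E k y)" for k R
  let ?L = "live n s"
  define I where "I k t \<longleftrightarrow> live n t \<subseteq> ?L \<and> (\<forall>S \<subseteq> ?L. min_deg2 E S \<longrightarrow> S \<subseteq> live n t) \<and>
    (live n t = ?L \<longrightarrow> (\<forall>v \<in> ?L. v < k \<longrightarrow> two v ?L))" for k t
  have lv: "live n (set_var ''i'' k t) = live n t" for k t by (simp add: live_def)
  have n: "s ''n'' 0 = n" using g by (simp add: stores_graph_n)
  have "I (s ''n'' 0) (sem strip_round s)"
    unfolding strip_round_def
  proof (rule sem_For_inv)
    show "I 0 (set_var ''i'' 0 s)" by (simp add: I_def lv)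
    fix k t assume k: "k < s ''n'' 0" "t ''i'' 0 = k" and It: "I k t"
      and fr: "\<And>x. x \<notin> writes (For ''i'' strip_step) \<Longrightarrow> t x = s x"
    have g': "stores_graph n E t"
      by (rule stores_graph_cong[OF g]) (simp_all add: fr strip_step_def deg_step_def)
    have L: "live n (sem strip_step t) = (if two k (live n t) then live n t else live n t - {k})"
      unfolding two_def using strip_step_spec[OF g'] k n by simp
    have "k \<notin> S" if "\<not> two k (live n t)" "S \<subseteq> live n t" "min_deg2 E S" for S
      using that unfolding two_def min_deg2_def by blast
    then show "I (Suc k) (set_var ''i'' (Suc k) (sem strip_step t))"
      using It unfolding I_def lv L less_Suc_eq by (auto split: if_splits)
  qed
  then have I: "I n (sem strip_round s)" unfolding n .
  then show "live n (sem strip_round s) \<subseteq> live n s"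
    and "\<forall>S \<subseteq> live n s. min_deg2 E S \<longrightarrow> S \<subseteq> live n (sem strip_round s)"
    unfolding I_def by blast+
  show "min_deg2 E (live n s)" if "live n (sem strip_round s) = live n s"
    using I that unfolding I_def two_def min_deg2_def by (auto simp: live_def)
qed

text \<open>Rounds keep removing vertices until the live set has minimum degree 2, which happens
  within \<open>n\<close> rounds. The result contains every subset of minimum degree 2, so
  acyclicity means that it is empty.\<close>

lemma check_forest_spec:
  assumes g: "stores_graph n E s"
  shows "0 < sem check_forest s ''bad'' 0 \<longleftrightarrow> 0 < s ''bad'' 0 \<or> \<not> acyc E ({..<n} - members n ''c'' s)"
proof -
  let ?F = "{..<n} - members n ''c'' s"
  let ?cp = "For ''i'' (put_at ''rem'' ''i'' (cell ''c'' ''i''))"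
  let ?fin = "Ite (nz (cell ''rem'' ''i'')) Nop (put ''bad'' (Num 1))"
  define s1 where "s1 = sem ?cp s"
  define s2 where "s2 = sem (For ''r'' strip_round) s1"
  have n: "s ''n'' 0 = n" using g by (simp add: stores_graph_n)
  have s1_fr: "s1 x = s x" if "x \<notin> {''rem'', ''i''}" for x
    unfolding s1_def using that by (subst sem_frame) auto
  have s2_fr: "s2 x = s1 x" if "x \<notin> {''rem'', ''i'', ''r'', ''j'', ''deg''}" for x
    unfolding s2_def using that by (subst sem_frame) (auto simp: strip_round_def strip_step_def deg_step_def)
  have "s1 ''rem'' = (\<lambda>m. if m < s ''n'' 0 then s ''c'' m else s ''rem'' m)"
    unfolding s1_def by (rule sem_For_map) auto
  then have live1: "live n s1 = ?F" unfolding live_def members_def n by auto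
  have g1: "stores_graph n E s1" by (rule stores_graph_cong[OF g]) (simp_all add: s1_fr)
  have n1: "s1 ''n'' 0 = n" using g1 by (simp add: stores_graph_n)
  \<comment> \<open>While rounds still remove vertices, the number of live ones plus the number of
    rounds stays at most \<open>n\<close>. After \<open>n\<close> rounds this leaves the empty set,
    which has minimum degree 2 vacuously.\<close>
  define I where "I r t \<longleftrightarrow> live n t \<subseteq> ?F \<and> (\<forall>S \<subseteq> ?F. min_deg2 E S \<longrightarrow> S \<subseteq> live n t) \<and>
    (card (live n t) + r \<le> n \<or> min_deg2 E (live n t))" for r t
  have lv: "live n (set_var ''r'' k t) = live n t" for k t by (simp add: live_def)
  have fin: "finite (live n t)" for t by (simp add: live_def)
  have "I (s1 ''n'' 0) s2"
    unfolding s2_def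
  proof (rule sem_For_inv)
    have "card ?F \<le> n" using card_mono[of "{..<n}" ?F] by simp
    then show "I 0 (set_var ''r'' 0 s1)" by (simp add: I_def lv live1)
    fix r t assume "t ''r'' 0 = r" and It: "I r t"
      and fr: "\<And>x. x \<notin> writes (For ''r'' strip_round) \<Longrightarrow> t x = s1 x"
    have g': "stores_graph n E t"
      by (rule stores_graph_cong[OF g1]) (simp_all add: fr strip_round_def strip_step_def deg_step_def)
    note R = strip_round_spec[OF g']
    have "card (live n (sem strip_round t)) + Suc r \<le> n \<or> min_deg2 E (live n (sem strip_round t))"
    proof (cases "live n (sem strip_round t) = live n t")
      case True
      then show ?thesis using R(3) by simp
    next
      case False
      then have "card (live n (sem strip_round t)) < card (live n t)"
        using R(1) fin by (intro psubset_card_mono) auto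
      moreover have "\<not> min_deg2 E (live n t)" using False R(1,2) by blast
      ultimately show ?thesis using It unfolding I_def by linarith
    qed
    moreover have "live n (sem strip_round t) \<subseteq> ?F" using It R(1) unfolding I_def by (meson subset_trans)
    moreover have "\<forall>S \<subseteq> ?F. min_deg2 E S \<longrightarrow> S \<subseteq> live n (sem strip_round t)"
      using It R(2) unfolding I_def by meson
    ultimately show "I (Suc r) (set_var ''r'' (Suc r) (sem strip_round t))"
      unfolding I_def lv by simp
  qed
  then have I: "I n s2" unfolding n1 .
  then have "card (live n s2) = 0 \<or> min_deg2 E (live n s2)" unfolding I_def by auto
  then have "min_deg2 E (live n s2)" using fin by (auto simp: min_deg2_def)
  moreover have "live n s2 \<subseteq> ?F" "\<forall>S \<subseteq> ?F. min_deg2 E S \<longrightarrow> S \<subseteq> live n s2" using I unfolding I_def by simp_all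
  ultimately have ac: "acyc E ?F \<longleftrightarrow> live n s2 = {}" unfolding acyc_def by (metis subset_empty)
  have n2: "s2 ''n'' 0 = n" using n1 s2_fr by simp
  have "0 < sem (For ''i'' ?fin) s2 ''bad'' 0 \<longleftrightarrow> 0 < s2 ''bad'' 0 \<or> (\<exists>k < s2 ''n'' 0. s2 ''rem'' k = 0)"
    by (rule sem_For_flag) auto
  moreover have "sem check_forest s = sem (For ''i'' ?fin) s2"
    by (simp add: check_forest_def s1_def s2_def)
  ultimately show ?thesis
    unfolding ac n2 by (auto simp: live_def s1_fr s2_fr)
qed

text \<open>\<open>Cs\<close> collects the candidates tested so far. Cells from \<open>n\<close> on
  must be zero because decoding reads the whole array \<open>set\<close>.\<close>

definition best_of :: "nat \<Rightarrow> (nat \<Rightarrow> nat \<Rightarrow> bool) \<Rightarrow> nat set set \<Rightarrow> state \<Rightarrow> bool" where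
  "best_of n E Cs s \<longleftrightarrow> (\<forall>v \<ge> n. s ''set'' v = 0) \<and>
     (if s ''found'' 0 = 0 then \<forall>A \<in> Cs. \<not> ifvs {..<n} E A
      else ifvs {..<n} E {v. s ''set'' v \<noteq> 0} \<and> s ''best'' 0 = card {v. s ''set'' v \<noteq> 0} \<and>
        (\<forall>A \<in> Cs. ifvs {..<n} E A \<longrightarrow> card {v. s ''set'' v \<noteq> 0} \<le> card A))"

lemma best_of_cong:
  "\<lbrakk>best_of n E Cs s; t ''set'' = s ''set''; t ''found'' = s ''found''; t ''best'' = s ''best''\<rbrakk> \<Longrightarrow>
    best_of n E Cs t"
  by (simp only: best_of_def)

lemma keep_best_spec:
  assumes n: "s ''n'' 0 = n" and bad: "0 < s ''bad'' 0 \<longleftrightarrow> \<not> ifvs {..<n} E (members n ''c'' s)"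
    and best: "best_of n E Cs s"
  shows "best_of n E (insert (members n ''c'' s) Cs) (sem keep_best s)"
proof -
  let ?A = "members n ''c'' s"
  let ?cnt = "Ite (nz (cell ''c'' ''i'')) (put ''size'' (Add (var ''size'') (Num 1))) Nop"
  let ?cp = "For ''i'' (put_at ''set'' ''i'' (cell ''c'' ''i''))"
  let ?test = "Conj (Neg (nz (var ''bad''))) (disj (Neg (nz (var ''found''))) (Less (var ''size'') (var ''best'')))"
  define s0 where "s0 = sem (put ''size'' (Num 0)) s"
  define s1 where "s1 = sem (For ''i'' ?cnt) s0"
  define s2 where "s2 = sem (put ''best'' (var ''size'')) (sem (put ''found'' (Num 1)) s1)"
  have s1_fr: "s1 x = s x" if "x \<notin> {''size'', ''i''}" for x
    unfolding s1_def using that by (subst sem_frame) (auto simp: s0_def)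
  have "s1 ''size'' 0 = s0 ''size'' 0 + (\<Sum>k < s0 ''n'' 0. if 0 < s ''c'' k then 1 else 0)"
    unfolding s1_def
  proof (rule sem_For_sum, simp)
    fix k t assume "t ''i'' 0 = k" "\<And>x. x \<notin> writes (For ''i'' ?cnt) \<Longrightarrow> t x = s0 x"
    then show "sem ?cnt t ''size'' 0 = t ''size'' 0 + (if 0 < s ''c'' k then 1 else 0)"
      by (simp add: s0_def)
  qed
  moreover have "s0 ''n'' 0 = n" "s0 ''size'' 0 = 0" using n by (simp_all add: s0_def)
  ultimately have size: "s1 ''size'' 0 = card ?A" unfolding sum_indicator members_def by simp
  have sem: "sem keep_best s = (if test_val ?test s1 then sem ?cp s2 else s1)"
    by (simp add: keep_best_def s0_def s1_def s2_def del: test_val.simps)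
  have test: "test_val ?test s1 \<longleftrightarrow> ifvs {..<n} E ?A \<and> (s ''found'' 0 = 0 \<or> card ?A < s ''best'' 0)"
    using bad by (auto simp: s1_fr size)
  show ?thesis
  proof (cases "test_val ?test s1")
    case True
    have s2: "s2 ''n'' 0 = n" "s2 ''c'' = s ''c''" "s2 ''set'' = s ''set''" "s2 ''found'' 0 = 1"
      "s2 ''best'' 0 = card ?A"
      using n size by (simp_all add: s2_def s1_fr)
    define s3 where "s3 = sem ?cp s2"
    have fr: "s3 x = s2 x" if "x \<notin> {''set'', ''i''}" for x
      unfolding s3_def using that by (subst sem_frame) auto
    have "s3 ''set'' = (\<lambda>m. if m < s2 ''n'' 0 then s2 ''c'' m else s2 ''set'' m)"
      unfolding s3_def by (rule sem_For_map) auto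
    then have set: "s3 ''set'' = (\<lambda>m. if m < n then s ''c'' m else 0)"
      using best unfolding s2 best_of_def by (auto simp: fun_eq_iff)
    then have A: "{v. s3 ''set'' v \<noteq> 0} = ?A"
      unfolding members_def by auto
    have "sem keep_best s = s3" using True sem unfolding s3_def by simp
    moreover have "best_of n E (insert ?A Cs) s3"
      unfolding best_of_def A using True[unfolded test] best set
      by (auto simp: fr s2 best_of_def split: if_splits)
    ultimately show ?thesis by simp
  next
    case False
    then have eq: "sem keep_best s = s1" unfolding sem by (simp only: if_False)
    have "best_of n E (insert ?A Cs) s"
      using False[unfolded test] best unfolding best_of_def by auto
    then show ?thesis unfolding eq by (rule best_of_cong) (simp_all add: s1_fr)
  qed
qed

lemma try_candidate_spec:
  assumes g: "stores_graph n E s" and best: "best_of n E Cs s"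
  shows "best_of n E (insert (members n ''c'' s) Cs) (sem try_candidate s)"
proof -
  define s1 where "s1 = sem check_indep s"
  define s2 where "s2 = sem check_forest s1"
  have fr1: "s1 x = s x" if "x \<notin> {''bad'', ''i'', ''j''}" for x
    unfolding s1_def using that by (subst sem_frame) (auto simp: check_indep_def indep_step_def)
  have fr2: "s2 x = s1 x" if "x \<notin> {''bad'', ''i'', ''j'', ''r'', ''rem'', ''deg''}" for x
    unfolding s2_def using that
    by (subst sem_frame) (auto simp: check_forest_def strip_round_def strip_step_def deg_step_def)
  have g1: "stores_graph n E s1" by (rule stores_graph_cong[OF g]) (simp_all add: fr1)
  have m: "members n ''c'' s1 = members n ''c'' s" "members n ''c'' s2 = members n ''c'' s"
    by (simp_all add: members_def fr1 fr2)
  have "0 < s2 ''bad'' 0 \<longleftrightarrow> \<not> ifvs {..<n} E (members n ''c'' s2)"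
    unfolding s2_def check_forest_spec[OF g1]
    using check_indep_spec[OF g] unfolding s2_def[symmetric] m s1_def[symmetric] ifvs_def
    by (auto simp: members_def)
  moreover have "best_of n E Cs s2" by (rule best_of_cong[OF best]) (simp_all add: fr1 fr2)
  moreover have "s2 ''n'' 0 = n" using g by (simp add: fr1 fr2 stores_graph_n)
  ultimately have "best_of n E (insert (members n ''c'' s2) Cs) (sem keep_best s2)"
    by (intro keep_best_spec)
  then show ?thesis unfolding m by (simp add: try_candidate_def s1_def s2_def)
qed

section \<open>Candidates given by three vertices\<close>

lemma make_tri_spec:
  assumes g: "stores_graph n E s" and uvx: "s ''u'' 0 < n" "s ''v'' 0 < n" "s ''x'' 0 < n"
  shows "members n ''c'' (sem make_tri s) = tri {..<n} E (s ''u'' 0) (s ''v'' 0) (s ''x'' 0)"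
proof -
  let ?T = "tri {..<n} E (s ''u'' 0) (s ''v'' 0) (s ''x'' 0)"
  have n: "s ''n'' 0 = n" using g by (simp add: stores_graph_n)
  have "sem make_tri s ''c'' = (\<lambda>m. if m < s ''n'' 0 then if m \<in> ?T then 1 else 0 else s ''c'' m)"
    unfolding make_tri_def
  proof (rule sem_For_map, simp)
    fix w t assume w: "w < s ''n'' 0" "t ''w'' 0 = w"
      and fr: "\<And>x. x \<notin> writes (For ''w'' tri_step) \<Longrightarrow> t x = s x"
    let ?t = "sem (put ''f'' (Num 0)) t"
    define t' where "t' = sem (For ''z'' tri_flag) ?t"
    have "0 < t' ''f'' 0 \<longleftrightarrow>
      0 < ?t ''f'' 0 \<or> (\<exists>z < ?t ''n'' 0. \<not> E z (s ''u'' 0) \<and> \<not> E z (s ''v'' 0) \<and> E w z)"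
      unfolding t'_def
    proof (rule sem_For_flag, simp)
      fix z r assume z: "z < ?t ''n'' 0" "r ''z'' 0 = z"
        and fr': "\<And>x. x \<notin> writes (For ''z'' tri_flag) \<Longrightarrow> r x = ?t x"
      have r: "r ''u'' = s ''u''" "r ''v'' = s ''v''" "r ''w'' 0 = w" and zn: "z < n"
        using w z n by (simp_all add: fr fr' tri_step_def tri_flag_def)
      have gr: "stores_graph n E r"
        by (rule stores_graph_cong[OF g]) (simp_all add: fr fr' tri_step_def tri_flag_def)
      show "0 < sem tri_flag r ''f'' 0 \<longleftrightarrow>
        0 < r ''f'' 0 \<or> \<not> E z (s ''u'' 0) \<and> \<not> E z (s ''v'' 0) \<and> E w z"
        using uvx w z n zn by (simp add: tri_flag_def edge_val[OF gr] r)
    qed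
    moreover have "?t ''n'' 0 = n" using n by (simp add: fr tri_step_def tri_flag_def)
    ultimately have f: "0 < t' ''f'' 0 \<longleftrightarrow> (\<exists>z < n. \<not> E z (s ''u'' 0) \<and> \<not> E z (s ''v'' 0) \<and> E w z)"
      by simp
    have frt: "t' x = t x" if "x \<notin> {''z'', ''f''}" for x
      unfolding t'_def using that by (subst sem_frame) (auto simp: tri_flag_def)
    have t': "t' ''u'' = s ''u''" "t' ''v'' = s ''v''" "t' ''x'' = s ''x''" "t' ''w'' 0 = w" "t' ''c'' = t ''c''"
      using w by (simp_all add: frt fr tri_step_def tri_flag_def)
    have gt: "stores_graph n E t'"
      by (rule stores_graph_cong[OF g]) (simp_all add: frt fr tri_step_def tri_flag_def)
    have "sem tri_step t = sem (Ite (Conj (neq ''w'' ''u'') (Conj (neq ''w'' ''v'') (Conj (neq ''w'' ''x'')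
         (disj (edge ''w'' ''v'') (Conj (edge ''w'' ''u'') (disj (edge ''w'' ''x'') (nz (var ''f''))))))))
       (put_at ''c'' ''w'' (Num 1)) (put_at ''c'' ''w'' (Num 0))) t'"
      unfolding tri_step_def t'_def by simp
    then show "sem tri_step t ''c'' = (t ''c'')(w := if w \<in> ?T then 1 else 0)"
      using uvx w n by (auto simp: edge_val[OF gt] t' f tri_def)
  qed
  then show ?thesis unfolding n members_def by (auto simp: tri_def)
qed

section \<open>Components and their two sides\<close>

lemma members_set_var [simp]: "a \<noteq> i \<Longrightarrow> members n a (set_var i k s) = members n a s"
  by (simp add: members_def)

text \<open>The invariant refers to the set \<open>D\<close> of index pairs already handled, which
  replaces separate invariants for the two nested loops.\<close>

lemma sem_For2_inv:
  assumes n: "s ''n'' 0 = n" and ij: "i \<noteq> j" "i \<notin> writes c" "''n'' \<notin> writes (For i (For j c))"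
    and init: "I {} s" and counter: "\<And>D k t. I D t \<Longrightarrow> I D (set_var i k t)" "\<And>D k t. I D t \<Longrightarrow> I D (set_var j k t)"
    and step: "\<And>a b D t. a < n \<Longrightarrow> b < n \<Longrightarrow> t i 0 = a \<Longrightarrow> t j 0 = b \<Longrightarrow>
      (\<And>x. x \<notin> writes (For i (For j c)) \<Longrightarrow> t x = s x) \<Longrightarrow> I D t \<Longrightarrow> I (insert (a, b) D) (sem c t)"
  shows "I ({..<n} \<times> {..<n}) (sem (For i (For j c)) s)"
proof -
  have "I ({..<s ''n'' 0} \<times> {..<n}) (sem (For i (For j c)) s)"
  proof (rule sem_For_inv[where I = "\<lambda>k t. I ({..<k} \<times> {..<n}) t"])
    show "I ({..<0} \<times> {..<n}) (set_var i 0 s)" using init counter(1) by simp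
    fix k t assume k: "k < s ''n'' 0" "t i 0 = k" and It: "I ({..<k} \<times> {..<n}) t"
      and fr: "\<And>x. x \<notin> writes (For i (For j c)) \<Longrightarrow> t x = s x"
    have tn: "t ''n'' 0 = n" using fr[OF ij(3)] n by simp
    have "I ({..<k} \<times> {..<n} \<union> {k} \<times> {..<t ''n'' 0}) (sem (For j c) t)"
    proof (rule sem_For_inv[where I = "\<lambda>m r. I ({..<k} \<times> {..<n} \<union> {k} \<times> {..<m}) r"])
      show "I ({..<k} \<times> {..<n} \<union> {k} \<times> {..<0}) (set_var j 0 t)" using It counter(2) by simp
      fix m r assume m: "m < t ''n'' 0" "r j 0 = m" and Ir: "I ({..<k} \<times> {..<n} \<union> {k} \<times> {..<m}) r"
        and fr': "\<And>x. x \<notin> writes (For j c) \<Longrightarrow> r x = t x"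
      have "r i 0 = k" using fr'[of i] ij k by simp
      then have "I (insert (k, m) ({..<k} \<times> {..<n} \<union> {k} \<times> {..<m})) (sem c r)"
        using m k n tn Ir by (intro step) (simp_all add: fr fr')
      moreover have "insert (k, m) ({..<k} \<times> {..<n} \<union> {k} \<times> {..<m}) = {..<k} \<times> {..<n} \<union> {k} \<times> {..<Suc m}"
        by (auto simp: less_Suc_eq)
      ultimately show "I ({..<k} \<times> {..<n} \<union> {k} \<times> {..<Suc m}) (set_var j (Suc m) (sem c r))"
        using counter(2) by simp
    qed
    moreover have "{..<k} \<times> {..<n} \<union> {k} \<times> {..<n} = {..<Suc k} \<times> {..<n}"
      by (auto simp: less_Suc_eq)
    ultimately show "I ({..<Suc k} \<times> {..<n}) (set_var i (Suc k) (sem (For j c) t))"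
      unfolding tn using counter(1) by simp
  qed
  then show ?thesis unfolding n .
qed

text \<open>An edge inside \<open>W\<close> makes every bipartition separate \<open>a\<close> from
  \<open>b\<close>, so \<open>b\<close> is forced to the side opposite to \<open>a\<close>.\<close>

lemma confined_insert:
  assumes "confined E W x P Q" "a \<in> W" "b \<in> W" "E a b"
  shows "a \<in> P \<Longrightarrow> confined E W x P (insert b Q)" and "a \<in> Q \<Longrightarrow> confined E W x (insert b P) Q"
proof -
  have B: "x \<in> B \<Longrightarrow> P \<subseteq> B \<and> Q \<inter> B = {}" "x \<notin> B \<Longrightarrow> Q \<subseteq> B \<and> P \<inter> B = {}"
    and ab: "a \<in> B \<longleftrightarrow> b \<notin> B" if "bipart E W B" for B
    using assms that unfolding confined_def bipart_def indep_def by simp_all blast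
  have x: "x \<in> P" "P \<union> Q \<subseteq> W" using assms(1) unfolding confined_def by simp_all
  show "confined E W x P (insert b Q)" if "a \<in> P"
    unfolding confined_def using x that assms(3) B ab by blast
  show "confined E W x (insert b P) Q" if "a \<in> Q"
    unfolding confined_def using x that assms(3) B ab by blast
qed

text \<open>An edge joins distinct vertices, so writing to \<open>q[j]\<close> cannot alter the
  entry \<open>q[i]\<close> tested next; both updates therefore refer to the original sets.\<close>

lemma reach_step_spec:
  assumes g: "stores_graph n E s" and irrefl: "\<And>v. \<not> E v v"
    and ab: "s ''i'' 0 = a" "s ''j'' 0 = b" "a < n" "b < n" and u: "s ''u'' 0 = u"
  shows "members n ''p'' (sem reach_step s) =
      (if a \<noteq> u \<and> b \<noteq> u \<and> E a b \<and> a \<in> members n ''q'' s then insert b (members n ''p'' s) else members n ''p'' s)"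
    and "members n ''q'' (sem reach_step s) =
      (if a \<noteq> u \<and> b \<noteq> u \<and> E a b \<and> a \<in> members n ''p'' s then insert b (members n ''q'' s) else members n ''q'' s)"
  using ab u irrefl by (auto simp: reach_step_def edge_val[OF g] members_def)

text \<open>If the union of the two sets has not grown by the end of the round, all pairs were
  tested against that same union, which is therefore closed. The last claim lets rounds be counted:
  a round that enlarges the union did not start from a closed one.\<close>

lemma reach_round_spec:
  fixes s n
  defines "P \<equiv> members n ''p''" and "Q \<equiv> members n ''q''"
  assumes g: "stores_graph n E s" and irrefl: "\<And>v. \<not> E v v"
    and u: "s ''u'' 0 = u" and W: "W = {..<n} - {u}" and conf: "confined E W x (P s) (Q s)"
  defines "t \<equiv> sem reach_round s"
  shows "confined E W x (P t) (Q t)" and "P s \<union> Q s \<subseteq> P t \<union> Q t"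
    and "P t \<union> Q t = P s \<union> Q s \<Longrightarrow> closed_under E W (P s \<union> Q s)"
    and "closed_under E W (P s \<union> Q s) \<Longrightarrow> P t \<union> Q t = P s \<union> Q s"
proof -
  define K where "K t = P t \<union> Q t" for t
  define I where "I D t \<longleftrightarrow> confined E W x (P t) (Q t) \<and> K s \<subseteq> K t \<and>
    (K t = K s \<longrightarrow> (\<forall>(a, b) \<in> D. a \<in> K s \<longrightarrow> b \<in> W \<longrightarrow> E a b \<longrightarrow> b \<in> K s)) \<and>
    (closed_under E W (K s) \<longrightarrow> K t = K s)" for D t
  have "I ({..<n} \<times> {..<n}) t"
    unfolding t_def reach_round_def
  proof (rule sem_For2_inv)
    show "s ''n'' 0 = n" using g by (simp add: stores_graph_n)
    show "I {} s" using conf by (simp add: I_def)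
    show "I D (set_var ''i'' k r)" "I D (set_var ''j'' k r)" if "I D r" for D k r
      using that by (simp_all add: I_def K_def P_def Q_def)
    fix a b D r assume ab: "a < n" "b < n" "r ''i'' 0 = a" "r ''j'' 0 = b" and Ir: "I D r"
      and fr: "\<And>x. x \<notin> writes (For ''i'' (For ''j'' reach_step)) \<Longrightarrow> r x = s x"
    have gr: "stores_graph n E r" by (rule stores_graph_cong[OF g]) (simp_all add: fr reach_step_def)
    have ur: "r ''u'' 0 = u" using u by (simp add: fr reach_step_def)
    note st = reach_step_spec[OF gr irrefl ab(3,4,1,2) ur, folded P_def Q_def]
    have cr: "confined E W x (P r) (Q r)" and Kr: "K s \<subseteq> K r" using Ir unfolding I_def by blast+
    then have "confined E W x (P (sem reach_step r)) (Q (sem reach_step r)) \<and>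
      K (sem reach_step r) = (if a \<in> K r \<and> b \<in> W \<and> E a b then insert b (K r) else K r)"
    proof -
      have "P r \<union> Q r \<subseteq> W" using cr unfolding confined_def by blast
      then have aW: "a \<in> P r \<or> a \<in> Q r \<Longrightarrow> a \<in> W \<and> a \<noteq> u" and bW: "b \<in> W \<longleftrightarrow> b \<noteq> u"
        unfolding W using ab by auto
      \<comment> \<open>The writes are followed in program order: first \<open>q\<close> is
        enlarged, then \<open>p\<close> with the new \<open>q\<close> in place.\<close>
      have c1: "confined E W x (P r) (Q (sem reach_step r))"
        unfolding st(2) using confined_insert(1)[OF cr, of a b] aW bW cr by auto
      have "Q r \<subseteq> Q (sem reach_step r)" unfolding st(2) by auto
      then have "confined E W x (P (sem reach_step r)) (Q (sem reach_step r))"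
        unfolding st(1) using confined_insert(2)[OF c1, of a b] aW bW c1 by auto
      moreover have "K (sem reach_step r) = (if a \<in> K r \<and> b \<in> W \<and> E a b then insert b (K r) else K r)"
        unfolding K_def st using aW bW by auto
      ultimately show ?thesis by blast
    qed
    moreover have "b \<in> K s" if "closed_under E W (K s)" "a \<in> K s" "b \<in> W" "E a b"
      using that unfolding closed_under_def by blast
    ultimately show "I (insert (a, b) D) (sem reach_step r)"
      using Ir Kr unfolding I_def by (auto split: if_splits)
  qed (simp_all add: reach_step_def)
  note It = this[unfolded I_def]
  have I: "confined E W x (P t) (Q t)" "K s \<subseteq> K t" "closed_under E W (K s) \<longrightarrow> K t = K s"
    using It by simp_all
  have cl: "b \<in> K s" if "K t = K s" "a < n" "b < n" "a \<in> K s" "b \<in> W" "E a b" for a b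
    using It[THEN conjunct2, THEN conjunct2, THEN conjunct1] that by blast
  show "confined E W x (P t) (Q t)" by (rule I(1))
  show "P s \<union> Q s \<subseteq> P t \<union> Q t" using I(2) unfolding K_def .
  show "P t \<union> Q t = P s \<union> Q s" if "closed_under E W (P s \<union> Q s)" using I(3) that unfolding K_def by blast
  show "closed_under E W (P s \<union> Q s)" if "P t \<union> Q t = P s \<union> Q s"
  proof -
    have "K s \<subseteq> {..<n}" by (auto simp: K_def P_def Q_def members_def)
    moreover have "W \<subseteq> {..<n}" using W by blast
    moreover have "K t = K s" using that unfolding K_def .
    ultimately show ?thesis using cl unfolding closed_under_def K_def[symmetric] by blast
  qed
qed

lemma make_sides_spec:
  assumes g: "stores_graph n E s" and irrefl: "\<And>v. \<not> E v v" and u: "s ''u'' 0 = u"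
    and x: "s ''x'' 0 = x" "x < n" "x \<noteq> u"
  shows "sides E ({..<n} - {u}) x (members n ''p'' (sem make_sides s)) (members n ''q'' (sem make_sides s))"
proof -
  let ?W = "{..<n} - {u}" and ?P = "members n ''p''" and ?Q = "members n ''q''"
  define s1 where "s1 = sem (For ''w'' (put_at ''p'' ''w'' (Num 0))) s"
  define s2 where "s2 = sem (For ''w'' (put_at ''q'' ''w'' (Num 0))) s1"
  define s3 where "s3 = sem (put_at ''p'' ''x'' (Num 1)) s2"
  define s4 where "s4 = sem (For ''r'' reach_round) s3"
  have n: "s ''n'' 0 = n" using g by (simp add: stores_graph_n)
  have fr1: "s1 y = s y" if "y \<notin> {''p'', ''w''}" for y
    unfolding s1_def using that by (subst sem_frame) auto
  have fr2: "s2 y = s1 y" if "y \<notin> {''q'', ''w''}" for y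
    unfolding s2_def using that by (subst sem_frame) auto
  have fr3: "s3 y = s2 y" if "y \<noteq> ''p''" for y
    unfolding s3_def using that by (subst sem_frame) auto
  have "s1 ''p'' = (\<lambda>m. if m < s ''n'' 0 then 0 else s ''p'' m)"
    unfolding s1_def by (rule sem_For_map) auto
  moreover have "s2 ''q'' = (\<lambda>m. if m < s1 ''n'' 0 then 0 else s1 ''q'' m)"
    unfolding s2_def by (rule sem_For_map) auto
  moreover have "s3 ''p'' = (s2 ''p'')(x := 1)" using x by (simp add: s3_def fr2 fr1)
  ultimately have P3: "?P s3 = {x}" and Q3: "?Q s3 = {}"
    using n x by (auto simp: members_def fr1 fr2 fr3)
  have g3: "stores_graph n E s3" by (rule stores_graph_cong[OF g]) (simp_all add: fr1 fr2 fr3)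
  have n3: "s3 ''n'' 0 = n" using g3 by (simp add: stores_graph_n)
  have u3: "s3 ''u'' 0 = u" using u by (simp add: fr1 fr2 fr3)
  define K where "K t = ?P t \<union> ?Q t" for t
  have fin: "finite (K t)" for t by (simp add: K_def members_def)
  \<comment> \<open>The union starts as \<open>{x}\<close>, with \<open>0 < 1\<close>, and grows in
    every round that does not find it closed. More than \<open>n\<close> vertices after
    \<open>n\<close> rounds are impossible, so it ends up closed.\<close>
  define I where "I r t \<longleftrightarrow> confined E ?W x (?P t) (?Q t) \<and> (r < card (K t) \<or> closed_under E ?W (K t))" for r t
  have "I (s3 ''n'' 0) s4"
    unfolding s4_def
  proof (rule sem_For_inv)
    have "confined E ?W x {x} {}" using x unfolding confined_def by auto
    then show "I 0 (set_var ''r'' 0 s3)"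
      using P3 Q3 by (simp add: I_def K_def)
    fix r t assume It: "I r t" and fr: "\<And>y. y \<notin> writes (For ''r'' reach_round) \<Longrightarrow> t y = s3 y"
    have gt: "stores_graph n E t"
      by (rule stores_graph_cong[OF g3]) (simp_all add: fr reach_round_def reach_step_def)
    have ut: "t ''u'' 0 = u" using u3 by (simp add: fr reach_round_def reach_step_def)
    have conf: "confined E ?W x (?P t) (?Q t)" using It unfolding I_def by blast
    note R = reach_round_spec[OF gt irrefl ut refl conf, folded K_def]
    have "Suc r < card (K (sem reach_round t)) \<or> closed_under E ?W (K (sem reach_round t))"
    proof (cases "K (sem reach_round t) = K t")
      case True
      then show ?thesis using R(3) by simp
    next
      case False
      then have "card (K t) < card (K (sem reach_round t))"
        using R(2) fin by (intro psubset_card_mono) auto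
      moreover have "\<not> closed_under E ?W (K t)" using False R(4) by blast
      ultimately show ?thesis using It unfolding I_def by auto
    qed
    then show "I (Suc r) (set_var ''r'' (Suc r) (sem reach_round t))"
      using R(1) by (simp add: I_def K_def)
  qed
  moreover have "card (K s4) \<le> n"
    using card_mono[of "{..<n}" "K s4"] by (auto simp: K_def members_def)
  ultimately have "sides E ?W x (?P s4) (?Q s4)"
    unfolding sides_def I_def n3 K_def by auto
  moreover have "sem make_sides s = s4" by (simp add: make_sides_def s1_def s2_def s3_def s4_def)
  ultimately show ?thesis by simp
qed

section \<open>Star candidates of least size\<close>

lemma sum_weighted:
  "(\<Sum>k < n. (if P k then 1 else 0) + (if Q k then c else 0)) = card {k :: nat. k < n \<and> P k} + c * card {k. k < n \<and> Q k}"
proof -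
  have "(\<Sum>k < n. if Q k then c else 0) = c * (\<Sum>k < n. if Q k then 1 else 0)"
    unfolding sum_distrib_left by (intro sum.cong) auto
  then show ?thesis by (simp add: sum.distrib sum_indicator)
qed

lemma choose_step_spec:
  assumes n: "s ''n'' 0 = n" and pq: "p \<notin> {''c'', ''w''}" "q \<notin> {''c'', ''w''}"
  shows "members n ''c'' (sem (For ''w'' (choose_step p q)) s) =
    members n ''c'' s - members n q s \<union> members n p s"
proof -
  have "sem (For ''w'' (choose_step p q)) s ''c'' = (\<lambda>m. if m < s ''n'' 0
      then if 0 < s p m then 1 else if 0 < s q m then 0 else s ''c'' m else s ''c'' m)"
  proof (rule sem_For_map, simp)
    fix k t assume k: "t ''w'' 0 = k" "t ''c'' k = s ''c'' k"
      and fr: "\<And>x. x \<notin> writes (For ''w'' (choose_step p q)) \<Longrightarrow> t x = s x"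
    have tpq: "t p = s p" "t q = s q" using pq by (simp_all add: fr choose_step_def)
    show "sem (choose_step p q) t ''c'' =
      (t ''c'')(k := if 0 < s p k then 1 else if 0 < s q k then 0 else s ''c'' k)"
      unfolding choose_step_def by (simp add: k tpq fun_upd_idem)
  qed
  then show ?thesis unfolding n members_def by (auto split: if_splits)
qed

lemma recolour_prog_spec:
  assumes g: "stores_graph n E s" and u: "s ''u'' 0 = u" "u < n"
  shows "members n ''c'' (sem recolour_prog s) =
    recolour {w. \<not> E w u} n (members n ''p'' s) (members n ''q'' s) (members n ''c'' s)"
proof -
  let ?N = "{w. \<not> E w u}" and ?P = "members n ''p'' s" and ?Q = "members n ''q'' s"
  define s0 where "s0 = sem (put ''b'' (Num 0)) (sem (put ''a'' (Num 0)) s)"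
  define s1 where "s1 = sem (For ''w'' cost_step) s0"
  have g0: "stores_graph n E s0" by (rule stores_graph_cong[OF g]) (simp_all add: s0_def)
  have n0: "s0 ''n'' 0 = n" using g0 by (simp add: stores_graph_n)
  have step: "sem cost_step t ''a'' 0 =
      t ''a'' 0 + ((if 0 < s ''p'' k then 1 else 0) + (if 0 < s ''q'' k \<and> \<not> E k u then n else 0))"
    "sem cost_step t ''b'' 0 =
      t ''b'' 0 + ((if 0 < s ''q'' k then 1 else 0) + (if 0 < s ''p'' k \<and> \<not> E k u then n else 0))"
    if k: "k < s0 ''n'' 0" "t ''w'' 0 = k"
      and fr: "\<And>x. x \<notin> writes (For ''w'' cost_step) \<Longrightarrow> t x = s0 x" for k t
  proof -
    have gt: "stores_graph n E t" by (rule stores_graph_cong[OF g0]) (simp_all add: fr cost_step_def)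
    have e: "test_val (edge ''w'' ''u'') r \<longleftrightarrow> E k u"
      if "r ''n'' = t ''n''" "r ''adj'' = t ''adj''" "r ''row'' = t ''row''" "r ''w'' = t ''w''" "r ''u'' = t ''u''" for r
    proof -
      have gr: "stores_graph n E r" by (rule stores_graph_cong[OF gt]) (simp_all add: that)
      have "r ''u'' 0 = u" using u that by (simp add: fr cost_step_def s0_def)
      then show ?thesis using edge_val[OF gr, of "''w''" "''u''"] k n0 u that by simp
    qed
    have "t ''p'' = s ''p''" "t ''q'' = s ''q''" "t ''n'' 0 = n"
      using n0 by (simp_all add: fr cost_step_def s0_def)
    then show "sem cost_step t ''a'' 0 =
        t ''a'' 0 + ((if 0 < s ''p'' k then 1 else 0) + (if 0 < s ''q'' k \<and> \<not> E k u then n else 0))"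
      "sem cost_step t ''b'' 0 =
        t ''b'' 0 + ((if 0 < s ''q'' k then 1 else 0) + (if 0 < s ''p'' k \<and> \<not> E k u then n else 0))"
      using k by (auto simp: cost_step_def e)
  qed
  have "s1 ''a'' 0 = s0 ''a'' 0 + (\<Sum>k < s0 ''n'' 0. (if 0 < s ''p'' k then 1 else 0) + (if 0 < s ''q'' k \<and> \<not> E k u then n else 0))"
    "s1 ''b'' 0 = s0 ''b'' 0 + (\<Sum>k < s0 ''n'' 0. (if 0 < s ''q'' k then 1 else 0) + (if 0 < s ''p'' k \<and> \<not> E k u then n else 0))"
    unfolding s1_def by (rule sem_For_sum, simp, rule step, assumption+)+
  then have ab: "s1 ''a'' 0 = card ?P + n * card (?Q \<inter> ?N)" "s1 ''b'' 0 = card ?Q + n * card (?P \<inter> ?N)"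
    unfolding n0 sum_weighted by (simp_all add: s0_def members_def Int_def conj_assoc)
  have fr1: "s1 x = s x" if "x \<notin> {''a'', ''b'', ''w''}" for x
    unfolding s1_def using that by (subst sem_frame) (auto simp: cost_step_def s0_def)
  have n1: "s1 ''n'' 0 = n" using n0 by (simp add: fr1 s0_def)
  have m: "members n ''p'' s1 = ?P" "members n ''q'' s1 = ?Q" "members n ''c'' s1 = members n ''c'' s"
    by (simp_all add: members_def fr1)
  have "sem recolour_prog s = (if s1 ''a'' 0 \<le> s1 ''b'' 0
      then sem (For ''w'' (choose_step ''p'' ''q'')) s1 else sem (For ''w'' (choose_step ''q'' ''p'')) s1)"
    by (simp add: recolour_prog_def s0_def s1_def)
  then show ?thesis
    unfolding recolour_def ab using choose_step_spec[of s1 n "''p''" "''q''"] choose_step_spec[of s1 n "''q''" "''p''"] n1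
    by (simp add: m)
qed

lemma make_star_spec:
  assumes E: "simple_graph {..<n} E" and g: "stores_graph n E s" and u: "s ''u'' 0 = u" "u < n"
    and A: "star {..<n} E u A"
  shows "star {..<n} E u (members n ''c'' (sem make_star s))" "card (members n ''c'' (sem make_star s)) \<le> card A"
proof -
  interpret simple_graph "{..<n}" E by fact
  let ?W = "{..<n} - {u}" and ?N = "{w. \<not> E w u}" and ?C = "members n ''c''"
  let ?cost = "side_cost ?N n ?W"
  define s1 where "s1 = sem (For ''w'' (put_at ''c'' ''w'' (Num 0))) s"
  define s2 where "s2 = sem (For ''x'' star_step) s1"
  have n: "s ''n'' 0 = n" using g by (simp add: stores_graph_n)
  have fr1: "s1 y = s y" if "y \<notin> {''c'', ''w''}" for y
    unfolding s1_def using that by (subst sem_frame) auto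
  have "s1 ''c'' = (\<lambda>m. if m < s ''n'' 0 then 0 else s ''c'' m)"
    unfolding s1_def by (rule sem_For_map) auto
  then have C1: "?C s1 = {}" unfolding n members_def by auto
  have n1: "s1 ''n'' 0 = n" using n by (simp add: fr1)
  text \<open>Recolouring the component of \<open>x\<close> overwrites all of it, so that only agreement with some
    cheap bipartition on the vertices processed so far has to be maintained.\<close>
  define I where "I k t \<longleftrightarrow> ?C t \<subseteq> ?W \<and> (\<exists>H. bipart E ?W H \<and> ?cost H \<le> ?cost A \<and>
    (\<forall>y < k. y \<noteq> u \<longrightarrow> (y \<in> ?C t \<longleftrightarrow> y \<in> H)))" for k t
  have mset: "?C (set_var ''x'' k t) = ?C t" for k t by (simp add: members_def)
  have "I (s1 ''n'' 0) s2"
    unfolding s2_def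
  proof (rule sem_For_inv)
    \<comment> \<open>\<open>H\<close> starts as the given \<open>A\<close>, with no vertices to
      agree on yet.\<close>
    show "I 0 (set_var ''x'' 0 s1)"
      using A unfolding I_def mset C1 star_def by auto
    fix k t assume k: "k < s1 ''n'' 0" "t ''x'' 0 = k" and It: "I k t"
      and fr: "\<And>y. y \<notin> writes (For ''x'' star_step) \<Longrightarrow> t y = s1 y"
    have gt: "stores_graph n E t"
      by (rule stores_graph_cong[OF g]) (simp_all add: fr fr1 prog_defs)
    have ut: "t ''u'' 0 = u" using u by (simp add: fr fr1 prog_defs)
    have kn: "k < n" using k n1 by simp
    show "I (Suc k) (set_var ''x'' (Suc k) (sem star_step t))"
    proof (cases "k = u")
      case True
      then have "sem star_step t = t" using k ut by (simp add: star_step_def)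
      then show ?thesis using It True unfolding I_def mset less_Suc_eq by auto
    next
      case False
      define t1 where "t1 = sem make_sides t"
      define t2 where "t2 = sem recolour_prog t1"
      have "sem star_step t = t2" using False k ut by (simp add: star_step_def t1_def t2_def)
      have frt: "t1 y = t y" if "y \<notin> {''w'', ''p'', ''q'', ''r'', ''i'', ''j''}" for y
        unfolding t1_def using that by (subst sem_frame) (auto simp: make_sides_def reach_round_def reach_step_def)
      have gt1: "stores_graph n E t1" by (rule stores_graph_cong[OF gt]) (simp_all add: frt)
      define P where "P = members n ''p'' t1"
      define Q where "Q = members n ''q'' t1"
      have PQ: "sides E ?W k P Q"
        unfolding P_def Q_def t1_def by (rule make_sides_spec[OF gt irrefl ut]) (use k kn False in auto)
      have "?C t1 = ?C t" by (simp add: members_def frt)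
      then have C: "?C t2 = recolour ?N n P Q (?C t)"
        using recolour_prog_spec[OF gt1] ut u unfolding t2_def P_def Q_def by (simp add: frt)
      obtain H where H: "bipart E ?W H" "?cost H \<le> ?cost A"
        and agree: "\<forall>y < k. y \<noteq> u \<longrightarrow> (y \<in> ?C t \<longleftrightarrow> y \<in> H)" and CW: "?C t \<subseteq> ?W"
        using It unfolding I_def by blast
      note R = recolour_bipart[OF _ PQ H(1), of ?N n]
      have kP: "k \<in> P" and PQW: "P \<union> Q \<subseteq> ?W" using PQ unfolding sides_def confined_def by blast+
      \<comment> \<open>\<open>recolour\<close> decides by \<open>P\<close> and \<open>Q\<close>
        alone, so it treats \<open>c\<close> and \<open>H\<close> alike: earlier agreements survive,
        and at \<open>k\<close>, which lies in \<open>P\<close>, both take the same colour.\<close>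
      have "y \<in> recolour ?N n P Q (?C t) \<longleftrightarrow> y \<in> recolour ?N n P Q H" if "y < Suc k" "y \<noteq> u" for y
        using that agree kP unfolding recolour_def less_Suc_eq by auto
      moreover have "recolour ?N n P Q (?C t) \<subseteq> ?W"
        using CW PQW unfolding recolour_def by auto
      moreover have "?cost (recolour ?N n P Q H) \<le> ?cost A" using R(2) H(2) by simp
      ultimately show ?thesis
        unfolding I_def mset \<open>sem star_step t = t2\<close> C using R(1) by blast
    qed
  qed
  then obtain H where H: "bipart E ?W H" "?cost H \<le> ?cost A"
    and agree: "\<forall>y < n. y \<noteq> u \<longrightarrow> (y \<in> ?C s2 \<longleftrightarrow> y \<in> H)" and CW: "?C s2 \<subseteq> ?W"
    unfolding I_def n1 by blast
  have "H \<subseteq> ?W" using H(1) unfolding bipart_def by blast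
  with agree CW have "?C s2 = H" by blast
  moreover have "sem make_star s = s2" by (simp add: make_star_def s1_def s2_def)
  ultimately show "star {..<n} E u (?C (sem make_star s))" "card (?C (sem make_star s)) \<le> card A"
    using cheap_bipart_star[OF _ A H(1)] H(2) u by simp_all
qed

section \<open>Enumeration of all candidates\<close>

lemma sem_For_best:
  assumes n: "s ''n'' 0 = n" and i: "i \<notin> {''set'', ''found'', ''best''}" and best: "best_of n E Cs s"
    and step: "\<And>k t Cs. k < n \<Longrightarrow> t i 0 = k \<Longrightarrow> (\<And>x. x \<notin> writes (For i c) \<Longrightarrow> t x = s x) \<Longrightarrow> best_of n E Cs t \<Longrightarrow>
      \<exists>Ds. Cs \<subseteq> Ds \<and> Good k Ds \<and> best_of n E Ds (sem c t)"
    and mono: "\<And>k Cs Ds. Good k Cs \<Longrightarrow> Cs \<subseteq> Ds \<Longrightarrow> Good k Ds"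
  shows "\<exists>Ds. Cs \<subseteq> Ds \<and> (\<forall>k < n. Good k Ds) \<and> best_of n E Ds (sem (For i c) s)"
proof -
  have sv: "best_of n E Ds (set_var i k t)" if "best_of n E Ds t" for Ds k t
    by (rule best_of_cong[OF that]) (use i in auto)
  have "\<exists>Ds. Cs \<subseteq> Ds \<and> (\<forall>k < s ''n'' 0. Good k Ds) \<and> best_of n E Ds (sem (For i c) s)"
  \<comment> \<open>The set of tested candidates is existentially quantified and may only grow;
    \<open>mono\<close> preserves what earlier rounds have achieved.\<close>
  proof (rule sem_For_inv[where I = "\<lambda>k t. \<exists>Ds. Cs \<subseteq> Ds \<and> (\<forall>m < k. Good m Ds) \<and> best_of n E Ds t"])
    show "\<exists>Ds. Cs \<subseteq> Ds \<and> (\<forall>m < 0. Good m Ds) \<and> best_of n E Ds (set_var i 0 s)"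
      using sv[OF best] by blast
    fix k t assume k: "k < s ''n'' 0" "t i 0 = k" "\<And>x. x \<notin> writes (For i c) \<Longrightarrow> t x = s x"
      and "\<exists>Ds. Cs \<subseteq> Ds \<and> (\<forall>m < k. Good m Ds) \<and> best_of n E Ds t"
    then obtain Ds where Ds: "Cs \<subseteq> Ds" "\<forall>m < k. Good m Ds" "best_of n E Ds t" by blast
    obtain Fs where Fs: "Ds \<subseteq> Fs" "Good k Fs" "best_of n E Fs (sem c t)"
      using step[OF _ k(2,3) Ds(3)] k(1) n by blast
    have "\<forall>m < Suc k. Good m Fs" using Ds(2) Fs(1,2) mono less_Suc_eq by metis
    with Ds(1) Fs(1) sv[OF Fs(3)]
    show "\<exists>Ds. Cs \<subseteq> Ds \<and> (\<forall>m < Suc k. Good m Ds) \<and> best_of n E Ds (set_var i (Suc k) (sem c t))"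
      by (meson subset_trans)
  qed
  then show ?thesis unfolding n .
qed

lemma tri_loops_spec:
  assumes g: "stores_graph n E s" and best: "best_of n E Cs s"
  defines "c \<equiv> make_tri ;; try_candidate"
  shows "\<exists>Ds. Cs \<subseteq> Ds \<and> (\<forall>u < n. \<forall>v < n. \<forall>x < n. tri {..<n} E u v x \<in> Ds) \<and>
    best_of n E Ds (sem (For ''u'' (For ''v'' (For ''x'' c))) s)"
proof (rule sem_For_best[OF stores_graph_n[OF g] _ best])
  fix u t1 Cs1 assume u: "u < n" "t1 ''u'' 0 = u" and b1: "best_of n E Cs1 t1"
    and fr1: "\<And>x. x \<notin> writes (For ''u'' (For ''v'' (For ''x'' c))) \<Longrightarrow> t1 x = s x"
  have g1: "stores_graph n E t1" by (rule stores_graph_cong[OF g]) (simp_all add: fr1 c_def prog_defs)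
  show "\<exists>Ds. Cs1 \<subseteq> Ds \<and> (\<forall>v < n. \<forall>x < n. tri {..<n} E u v x \<in> Ds) \<and>
    best_of n E Ds (sem (For ''v'' (For ''x'' c)) t1)"
  proof (rule sem_For_best[OF stores_graph_n[OF g1] _ b1])
    fix v t2 Cs2 assume v: "v < n" "t2 ''v'' 0 = v" and b2: "best_of n E Cs2 t2"
      and fr2: "\<And>x. x \<notin> writes (For ''v'' (For ''x'' c)) \<Longrightarrow> t2 x = t1 x"
    have g2: "stores_graph n E t2" by (rule stores_graph_cong[OF g1]) (simp_all add: fr2 c_def prog_defs)
    show "\<exists>Ds. Cs2 \<subseteq> Ds \<and> (\<forall>x < n. tri {..<n} E u v x \<in> Ds) \<and> best_of n E Ds (sem (For ''x'' c) t2)"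
    proof (rule sem_For_best[OF stores_graph_n[OF g2] _ b2])
      fix x t3 Cs3 assume x: "x < n" "t3 ''x'' 0 = x" and b3: "best_of n E Cs3 t3"
        and fr3: "\<And>y. y \<notin> writes (For ''x'' c) \<Longrightarrow> t3 y = t2 y"
      have g3: "stores_graph n E t3" by (rule stores_graph_cong[OF g2]) (simp_all add: fr3 c_def prog_defs)
      have uv: "t3 ''u'' 0 = u" "t3 ''v'' 0 = v" using u v by (simp_all add: fr2 fr3 c_def prog_defs)
      define t4 where "t4 = sem make_tri t3"
      have fr4: "t4 y = t3 y" if "y \<notin> {''c'', ''f'', ''w'', ''z''}" for y
        unfolding t4_def using that
        by (subst sem_frame) (auto simp: make_tri_def tri_step_def tri_flag_def)
      have g4: "stores_graph n E t4" by (rule stores_graph_cong[OF g3]) (simp_all add: fr4)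
      have b4: "best_of n E Cs3 t4" by (rule best_of_cong[OF b3]) (simp_all add: fr4)
      have "members n ''c'' t4 = tri {..<n} E u v x"
        unfolding t4_def using make_tri_spec[OF g3] u v x uv by simp
      then have "best_of n E (insert (tri {..<n} E u v x) Cs3) (sem c t3)"
        using try_candidate_spec[OF g4 b4] by (simp add: c_def t4_def)
      then show "\<exists>Ds. Cs3 \<subseteq> Ds \<and> tri {..<n} E u v x \<in> Ds \<and> best_of n E Ds (sem c t3)" by blast
    qed auto
  qed auto
qed auto

text \<open>If \<open>u\<close> is the centre of no star, \<open>make_star\<close> may build a
  useless set, but \<open>try_candidate\<close> keeps only sets that pass its tests.\<close>

lemma star_loop_spec:
  assumes E: "simple_graph {..<n} E" and g: "stores_graph n E s" and best: "best_of n E Cs s"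
  defines "c \<equiv> make_star ;; try_candidate"
  shows "\<exists>Ds. Cs \<subseteq> Ds \<and>
    (\<forall>u < n. \<forall>A. star {..<n} E u A \<longrightarrow> (\<exists>B \<in> Ds. star {..<n} E u B \<and> card B \<le> card A)) \<and>
    best_of n E Ds (sem (For ''u'' c) s)"
proof (rule sem_For_best[OF stores_graph_n[OF g] _ best])
  fix u t Cs assume u: "u < n" "t ''u'' 0 = u" and b: "best_of n E Cs t"
    and fr: "\<And>x. x \<notin> writes (For ''u'' c) \<Longrightarrow> t x = s x"
  have gt: "stores_graph n E t" by (rule stores_graph_cong[OF g]) (simp_all add: fr c_def prog_defs)
  define t1 where "t1 = sem make_star t"
  have fr1: "t1 y = t y" if "y \<notin> writes make_star" for y
    unfolding t1_def using that by (rule sem_frame)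
  have g1: "stores_graph n E t1" by (rule stores_graph_cong[OF gt]) (simp_all add: fr1 prog_defs)
  have b1: "best_of n E Cs t1" by (rule best_of_cong[OF b]) (simp_all add: fr1 prog_defs)
  let ?B = "members n ''c'' t1"
  have "best_of n E (insert ?B Cs) (sem c t)"
    using try_candidate_spec[OF g1 b1] by (simp add: c_def t1_def)
  moreover have "star {..<n} E u ?B \<and> card ?B \<le> card A" if "star {..<n} E u A" for A
    using make_star_spec[OF E gt u(2,1) that] unfolding t1_def by simp
  ultimately show "\<exists>Ds. Cs \<subseteq> Ds \<and>
    (\<forall>A. star {..<n} E u A \<longrightarrow> (\<exists>B \<in> Ds. star {..<n} E u B \<and> card B \<le> card A)) \<and> best_of n E Ds (sem c t)"
    by (intro exI[of _ "insert ?B Cs"]) blast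
next
  show "\<And>k Cs Ds. \<forall>A. star {..<n} E k A \<longrightarrow> (\<exists>B \<in> Cs. star {..<n} E k B \<and> card B \<le> card A) \<Longrightarrow> Cs \<subseteq> Ds \<Longrightarrow>
    \<forall>A. star {..<n} E k A \<longrightarrow> (\<exists>B \<in> Ds. star {..<n} E k B \<and> card B \<le> card A)" by blast
qed auto

text \<open>By \<open>ifvs_cases\<close> every solution is itself a tested candidate of the form
  \<open>tri\<close> or a star set. In the latter case some tested star set is at most as large, and
  \<open>star_ifvs\<close> makes it a solution.\<close>

lemma min_ifvs_prog_spec:
  assumes E: "diam2_graph {..<n} E"
    and s: "s ''n'' 0 = n" "s ''row'' 0 = 0" "s ''found'' 0 = 0" "\<And>v. s ''set'' v = 0"
    and adj: "\<And>i j. i < n \<Longrightarrow> j < n \<Longrightarrow> 0 < s ''adj'' (i * n + j) \<longleftrightarrow> E i j"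
  defines "t \<equiv> sem min_ifvs_prog s"
  shows "\<exists>Cs. best_of n E Cs t \<and> (\<forall>A. ifvs {..<n} E A \<longrightarrow> (\<exists>B \<in> Cs. ifvs {..<n} E B \<and> card B \<le> card A))"
proof -
  interpret diam2_graph "{..<n}" E by fact
  define s1 where "s1 = sem init_rows s"
  define s2 where "s2 = sem (For ''u'' (For ''v'' (For ''x'' (make_tri ;; try_candidate)))) s1"
  have fr1: "s1 y = s y" if "y \<notin> {''row'', ''i''}" for y
    unfolding s1_def using that by (subst sem_frame) (auto simp: init_rows_def)
  have fr2: "s2 y = s1 y" if "y \<in> {''n'', ''adj'', ''row''}" for y
    unfolding s2_def using that by (subst sem_frame) (auto simp: prog_defs)
  have "s1 ''row'' i = i * n" if "i < n" for i
    unfolding s1_def using init_rows_spec[of s i] s that by simp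
  then have g1: "stores_graph n E s1" unfolding stores_graph_def using s adj by (simp add: fr1)
  have b1: "best_of n E {} s1" using s by (simp add: best_of_def fr1)
  obtain Cs where Cs: "\<forall>u < n. \<forall>v < n. \<forall>x < n. tri {..<n} E u v x \<in> Cs" "best_of n E Cs s2"
    using tri_loops_spec[OF g1 b1, folded s2_def] by (elim exE conjE)
  have g2: "stores_graph n E s2" by (rule stores_graph_cong[OF g1]) (simp_all add: fr2)
  obtain Ds where Ds: "Cs \<subseteq> Ds" "best_of n E Ds (sem (For ''u'' (make_star ;; try_candidate)) s2)"
    "\<forall>u < n. \<forall>A. star {..<n} E u A \<longrightarrow> (\<exists>B \<in> Ds. star {..<n} E u B \<and> card B \<le> card A)"
    using star_loop_spec[OF simple_graph_axioms g2 Cs(2)] by (elim exE conjE)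
  have "t = sem (For ''u'' (make_star ;; try_candidate)) s2"
    by (simp add: t_def min_ifvs_prog_def s1_def s2_def)
  then have "best_of n E Ds t" using Ds(2) by simp
  moreover have "\<exists>B \<in> Ds. ifvs {..<n} E B \<and> card B \<le> card A" if A: "ifvs {..<n} E A" for A
    using ifvs_cases[OF A]
  proof
    assume "\<exists>u \<in> {..<n}. \<exists>v \<in> {..<n}. \<exists>x \<in> {..<n}. A = tri {..<n} E u v x"
    then have "A \<in> Ds" using Cs(1) Ds(1) by blast
    with A show ?thesis by blast
  next
    assume "\<exists>u \<in> {..<n}. star {..<n} E u A"
    then obtain u where "u < n" "star {..<n} E u A" by blast
    then show ?thesis using Ds(3) star_ifvs by blast
  qed
  ultimately show ?thesis by blast
qed

theorem theorem3:
  shows "poly_time_solvable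
           {G :: nat pair_pre_digraph. input_graph G \<and> graph_diameter (with_proj G) = 2}
           (\<lambda>G. min_indep_fvs_answer (with_proj G))
           (\<lambda>G. card (pverts G))
           encode_graph
           decode_vertex_set"
  unfolding poly_time_solvable_def
proof (rule exI[of _ "compile min_ifvs_prog"], rule exI[of _ "time_poly min_ifvs_prog"], rule ballI)
  fix G :: "nat pair_pre_digraph"
  assume "G \<in> {G. input_graph G \<and> graph_diameter (with_proj G) = 2}"
  then have G: "pair_graph G" "pverts G = {..<card (pverts G)}" "graph_diameter (with_proj G) = 2"
    by (simp_all add: input_graph_def)
  define n where "n = card (pverts G)"
  define E where "E = (\<lambda>x y. (x, y) \<in> parcs G)"
  define s where "s = encode_graph G"
  define t where "t = sem min_ifvs_prog s"
  have V: "pverts G = {..<n}" using G(2) unfolding n_def .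
  have D: "diam2_graph {..<n} E"
    using diam2_graph_of_diameter[OF G(1,3)] unfolding V E_def .
  have fvs: "indep_fvs (with_proj G) = ifvs {..<n} E"
    using indep_fvs_iff_ifvs[OF G(1)] unfolding V E_def by blast
  have s: "s ''n'' 0 = n" "s ''row'' 0 = 0" "s ''found'' 0 = 0" "\<And>v. s ''set'' v = 0"
    by (simp_all add: s_def encode_graph_def n_def Let_def)
  have adj: "0 < s ''adj'' (i * n + j) \<longleftrightarrow> E i j" if "i < n" "j < n" for i j
  proof -
    \<comment> \<open>Division with remainder by \<open>n\<close> recovers row and column, so each
      matrix entry encodes one pair only.\<close>
    have "i = a \<and> j = b" if "i * n + j = a * n + b" "b < n" for a b
      using that \<open>j < n\<close> by (metis add.commute div_mult_self3 div_less mod_less mod_mult_self1 less_nat_zero_code add_0)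
    then have "(\<exists>a < n. \<exists>b < n. i * n + j = a * n + b \<and> (a, b) \<in> parcs G) \<longleftrightarrow> E i j"
      using that unfolding E_def by blast
    then show ?thesis by (simp add: s_def encode_graph_def n_def Let_def)
  qed
  obtain Cs where best: "best_of n E Cs t"
    and Cs: "\<And>A. ifvs {..<n} E A \<Longrightarrow> \<exists>B \<in> Cs. ifvs {..<n} E B \<and> card B \<le> card A"
    using min_ifvs_prog_spec[OF D s adj] unfolding t_def by blast
  have "min_indep_fvs_answer (with_proj G) (decode_vertex_set t)"
  proof (cases "t ''found'' 0 = 0")
    case True
    then show ?thesis using best Cs unfolding decode_vertex_set_def best_of_def by (auto simp: fvs)
  next
    case False
    show ?thesis
    proof -
      let ?S = "{v. t ''set'' v \<noteq> 0}"
      have S: "ifvs {..<n} E ?S" "\<And>A. A \<in> Cs \<Longrightarrow> ifvs {..<n} E A \<Longrightarrow> card ?S \<le> card A"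
        using best False unfolding best_of_def by simp_all
      have "card ?S \<le> card A" if "ifvs {..<n} E A" for A
        using Cs[OF that] S(2) le_trans by blast
      then have "is_arg_min card (ifvs {..<n} E) ?S" unfolding is_arg_min_def using S(1) not_less by blast
      then show ?thesis using False unfolding decode_vertex_set_def by (simp add: fvs)
    qed
  qed
  moreover obtain k where "k \<le> poly (time_poly min_ifvs_prog) n" "runs (compile min_ifvs_prog) s k t"
    using compile_runs[of min_ifvs_prog s n] min_ifvs_prog_bounded s(1) unfolding t_def by blast
  ultimately show "\<exists>k t. runs (compile min_ifvs_prog) (encode_graph G) k t \<and>
    k \<le> poly (time_poly min_ifvs_prog) (card (pverts G)) \<and>
    min_indep_fvs_answer (with_proj G) (decode_vertex_set t)"
    unfolding s_def n_def by blast
qed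

end
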